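(* Let $d\ge 1$ and $n\ge 1$ be integers. The maximum $d$-dimensional volume of the convex hull of a facet-to-facet connected system of $n$ unit hypercubes in $\mathbb{R}^d$ is $$\sum_{I\subseteq\{1,\dots,d\}}\frac{1}{|I|!}\prod_{i\in I}\left\lfloor\frac{n-2+i}{d}\right\rfloor .$$
   Context: A facet-to-facet connected system of $n$ unit hypercubes in $\mathbb{R}^d$ (a $d$-dimensional polyomino with $n$ cells) is a set of $n$ distinct unit hypercubes of the integer grid in $\mathbb{R}^d$ such that any two of them are joined by a chain of hypercubes of the system in which consecutive hypercubes share a full $(d-1)$-dimensional facet. The convex hull is that of the union of the (closed) hypercubes. The empty product (for $I=\emptyset$) equals $1$. *)

theory Defs
  imports "HOL-Analysis.Analysis"
begin

definition grid_cube :: "(real^'d) set \<Rightarrow> bool" where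
  "grid_cube C \<longleftrightarrow>
    (\<exists>z :: int^'d. C = cbox (\<chi> i. of_int (z $ i)) (\<chi> i. of_int (z $ i) + 1))"

text \<open>A cube shares a facet with itself; this is harmless, since the relation is only
  used to form chains.\<close>

definition share_facet :: "(real^'d) set \<Rightarrow> (real^'d) set \<Rightarrow> bool" where
  "share_facet C D \<longleftrightarrow> (\<exists>F. F facet_of C \<and> F facet_of D)"

definition polyomino :: "nat \<Rightarrow> (real^'d) set set \<Rightarrow> bool" where
  "polyomino n P \<longleftrightarrow>
    finite P \<and> card P = n \<and> (\<forall>C\<in>P. grid_cube C) \<and>
    (\<forall>C\<in>P. \<forall>D\<in>P. (C, D) \<in> {(A, B). A \<in> P \<and> B \<in> P \<and> share_facet A B}\<^sup>*)"

text \<open>Unlike \<^const>\<open>Max\<close>, this asserts existence of the maximum without presupposing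
  that the set is finite.\<close>

definition is_maximum :: "real set \<Rightarrow> real \<Rightarrow> bool" where
  "is_maximum S m \<longleftrightarrow> m \<in> S \<and> (\<forall>x\<in>S. x \<le> m)"

end

theory Submission imports Defs begin

text \<open>Let \<open>K\<close> be the convex hull of the lower corners of the cubes. The hull of the polyomino is
  \<open>K + [0,1]\<^sup>d\<close>, and its volume is the sum over all \<open>I\<close> of the volumes of the projections of \<open>K\<close>
  to the coordinates \<open>I\<close>. Build up the corners from a single one by steps \<open>\<plusminus>e\<^sub>i\<close>, with \<open>a\<^sub>i\<close> steps
  in direction \<open>i\<close>. A step from \<open>p \<in> K\<close> in direction \<open>i\<close> enlarges a \<open>k\<close>-dimensional convex body
  by at most a pyramid of height 1 over its projection along \<open>i\<close>, that is, by at most \<open>1/k\<close> times the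
  volume of this projection; hence by induction the projection to \<open>I\<close> has volume at most
  \<open>(\<Prod>i\<in>I. a\<^sub>i) / |I|!\<close>. The sum of these bounds is largest when the \<open>a\<^sub>i\<close>, whose sum is \<open>n - 1\<close>, differ
  by at most 1, and star-shaped polyominoes with arms of lengths \<open>a\<^sub>i\<close> attain it.\<close>

subsection \<open>Slicing along a coordinate axis\<close>

text \<open>The estimate for one step in direction \<open>i\<close> bounds the projection to
  \<open>I\<close> in terms of the projection to \<open>I - {i}\<close>, so the bounds for all
  \<open>I\<close> have to pass through the induction together; \<open>shadow\<close> makes bodies
  of one space out of all these projections. The factorial comes from the recursion: with Q the
  product over the k - 1 other directions, the old bound a_i Q / k! and the pyramid (1/k) Q / (k -
  1)! add up to (a_i + 1) Q / k!. A new corner needs only a neighbour in the old hull, so neither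
  the sign of a step nor the order of growth matters. The numbers a_i do depend on that order and
  only their sum is known, which leaves a maximisation over all distributions of n - 1 steps. Any
  two entries enter the bound only through their sum and, with nonnegative coefficients, their
  product; hence moving a unit from a larger to a smaller entry never hurts. The floors in the
  theorem are the entries of the balanced distribution of n - 1 into d parts.\<close>

lemma emeasure_lborel_translate:
  fixes A :: "'a::euclidean_space set"
  assumes "A \<in> sets borel"
  shows "emeasure lborel {x. x + c \<in> A} = emeasure lborel A"
proof -
  have "emeasure lborel A = emeasure (distr lborel borel ((+) c)) A"
    by (simp add: lborel_distr_plus)
  also have "\<dots> = emeasure lborel ((+) c -` A \<inter> space lborel)"
    using assms by (intro emeasure_distr) auto
  finally show ?thesis by (simp add: vimage_def add.commute)
qed

lemma vec_nth_borel_measurable [measurable]: 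
  "(\<lambda>x::real^'d. x $ i) \<in> borel_measurable borel"
  by (intro borel_measurable_continuous_onI continuous_intros)

lemma measurable_axis_fibre [measurable]:
  fixes A :: "(real^'d) set"
  assumes A [measurable]: "A \<in> sets borel"
  shows "(\<lambda>x. emeasure lborel {t. x + t *\<^sub>R axis i 1 \<in> A}) \<in> borel_measurable borel"
proof -
  have [measurable]: "{t. x + t *\<^sub>R axis i 1 \<in> A} \<in> sets borel" for x by measurable
  have "(\<lambda>x. \<integral>\<^sup>+t. indicator A (x + t *\<^sub>R axis i 1) \<partial>lborel) \<in> borel_measurable borel"
    by measurable
  moreover have "(\<integral>\<^sup>+t. indicator A (x + t *\<^sub>R axis i 1) \<partial>lborel) = emeasure lborel {t. x + t *\<^sub>R axis i 1 \<in> A}" for x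
  proof -
    have "(\<integral>\<^sup>+t. indicator A (x + t *\<^sub>R axis i 1) \<partial>lborel) = (\<integral>\<^sup>+t. indicator {t. x + t *\<^sub>R axis i 1 \<in> A} t \<partial>lborel)"
      by (intro nn_integral_cong) (auto simp: indicator_def)
    thus ?thesis by simp
  qed
  ultimately show ?thesis by simp
qed

text \<open>The strip \<open>0 \<le> x$i \<le> 1\<close> of base points stands in for a hyperplane,
  so everything stays in \<open>real^'d\<close>. A point \<open>y\<close> of \<open>A\<close> is
  counted for exactly the \<open>t\<close> in \<open>{y$i - 1..y$i}\<close>, an interval of length
  1; the rest is Fubini.\<close>

lemma emeasure_axis_slices:
  fixes A :: "(real^'d) set"
  assumes A [measurable]: "A \<in> sets borel"
  shows "emeasure lborel A =
    (\<integral>\<^sup>+x. indicator {x. 0 \<le> x$i \<and> x$i \<le> 1} x * emeasure lborel {t. x + t *\<^sub>R axis i 1 \<in> A} \<partial>lborel)"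
    (is "_ = (\<integral>\<^sup>+x. indicator ?W x * _ \<partial>lborel)")
proof -
  have W [measurable]: "?W \<in> sets borel" by measurable
  have [measurable]: "{t. x + t *\<^sub>R axis i 1 \<in> A} \<in> sets borel" for x by measurable
  have "(\<integral>\<^sup>+x. indicator ?W x * emeasure lborel {t. x + t *\<^sub>R axis i 1 \<in> A} \<partial>lborel) =
      (\<integral>\<^sup>+x. (\<integral>\<^sup>+t. indicator ?W x * indicator A (x + t *\<^sub>R axis i 1) \<partial>lborel) \<partial>lborel)"
  proof (intro nn_integral_cong)
    fix x :: "real^'d"
    have "emeasure lborel {t. x + t *\<^sub>R axis i 1 \<in> A} = (\<integral>\<^sup>+t. indicator {t. x + t *\<^sub>R axis i 1 \<in> A} t \<partial>lborel)"
      by (subst nn_integral_indicator) auto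
    thus "indicator ?W x * emeasure lborel {t. x + t *\<^sub>R axis i 1 \<in> A} =
      (\<integral>\<^sup>+t. indicator ?W x * indicator A (x + t *\<^sub>R axis i 1) \<partial>lborel)"
      by (subst nn_integral_cmult) (auto simp: indicator_def)
  qed
  also have "\<dots> = (\<integral>\<^sup>+t. (\<integral>\<^sup>+x. indicator ?W x * indicator A (x + t *\<^sub>R axis i 1) \<partial>lborel) \<partial>lborel)"
    by (rule lborel_pair.Fubini') (measurable)
  also have "\<dots> = (\<integral>\<^sup>+t. (\<integral>\<^sup>+x. indicator ?W (x - t *\<^sub>R axis i 1) * indicator A x \<partial>lborel) \<partial>lborel)"
  proof (rule nn_integral_cong)
    fix t :: real
    have "(\<integral>\<^sup>+x. indicator ?W x * indicator A (x + t *\<^sub>R axis i 1) \<partial>lborel) =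
      (\<integral>\<^sup>+x. indicator ?W x * indicator A (x + t *\<^sub>R axis i 1) \<partial>distr lborel borel ((+) (- t *\<^sub>R axis i 1)))"
      by (simp only: lborel_distr_plus)
    also have "\<dots> = (\<integral>\<^sup>+x. indicator ?W (x - t *\<^sub>R axis i 1) * indicator A x \<partial>lborel)"
      by (subst nn_integral_distr) (auto)
    finally show "(\<integral>\<^sup>+x. indicator ?W x * indicator A (x + t *\<^sub>R axis i 1) \<partial>lborel) =
      (\<integral>\<^sup>+x. indicator ?W (x - t *\<^sub>R axis i 1) * indicator A x \<partial>lborel)" .
  qed
  also have "\<dots> = (\<integral>\<^sup>+x. (\<integral>\<^sup>+t. indicator ?W (x - t *\<^sub>R axis i 1) * indicator A x \<partial>lborel) \<partial>lborel)"
    by (rule lborel_pair.Fubini') (measurable)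
  also have "\<dots> = (\<integral>\<^sup>+x. indicator A x \<partial>lborel)"
  proof (rule nn_integral_cong)
    fix x :: "real^'d"
    have "(\<integral>\<^sup>+t. indicator ?W (x - t *\<^sub>R axis i 1) * indicator A x \<partial>lborel) =
       (\<integral>\<^sup>+t. indicator A x * indicator {x$i - 1..x$i} t \<partial>lborel)"
      by (intro nn_integral_cong) (auto simp: indicator_def)
    also have "\<dots> = indicator A x" by (subst nn_integral_cmult_indicator) auto
    finally show "(\<integral>\<^sup>+t. indicator ?W (x - t *\<^sub>R axis i 1) * indicator A x \<partial>lborel) = indicator A x" .
  qed
  finally show ?thesis by simp
qed

text \<open>Now the slices are perpendicular to the axis. Coordinate \<open>i\<close> of
  \<open>x\<close> is overwritten by the height \<open>s\<close> and itself runs freely through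
  [0,1], so the d-dimensional volume of the integrand set is the (d-1)-dimensional volume of the
  slice.\<close>

lemma emeasure_coordinate_slices:
  fixes A :: "(real^'d) set"
  assumes A [measurable]: "A \<in> sets borel"
  shows "emeasure lborel A =
    (\<integral>\<^sup>+s. emeasure lborel {x. 0 \<le> x$i \<and> x$i \<le> 1 \<and> x + (s - x$i) *\<^sub>R axis i 1 \<in> A} \<partial>lborel)"
proof -
  let ?W = "{x::real^'d. 0 \<le> x$i \<and> x$i \<le> 1}"
  have W [measurable]: "?W \<in> sets borel" by measurable
  have [measurable]: "{t. x + t *\<^sub>R axis i 1 \<in> A} \<in> sets borel" for x by measurable
  have [measurable]: "{s. x + (s - x$i) *\<^sub>R axis i 1 \<in> A} \<in> sets borel" for x by measurable
  have m [measurable]: "{x. 0 \<le> x$i \<and> x$i \<le> 1 \<and> x + (s - x$i) *\<^sub>R axis i 1 \<in> A} \<in> sets borel" for s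
    by measurable
  have "emeasure lborel A = (\<integral>\<^sup>+x. (\<integral>\<^sup>+s. indicator ?W x * indicator A (x + (s - x$i) *\<^sub>R axis i 1) \<partial>lborel) \<partial>lborel)"
    unfolding emeasure_axis_slices[OF A, of i]
  proof (rule nn_integral_cong)
    fix x :: "real^'d"
    have "emeasure lborel {t. x + t *\<^sub>R axis i 1 \<in> A} = emeasure lborel {s. s + - x$i \<in> {t. x + t *\<^sub>R axis i 1 \<in> A}}"
      by (subst emeasure_lborel_translate) auto
    also have "\<dots> = emeasure lborel {s. x + (s - x$i) *\<^sub>R axis i 1 \<in> A}" by simp
    also have "\<dots> = (\<integral>\<^sup>+t. indicator {s. x + (s - x$i) *\<^sub>R axis i 1 \<in> A} t \<partial>lborel)"
      by (subst nn_integral_indicator) auto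
    finally show "indicator ?W x * emeasure lborel {t. x + t *\<^sub>R axis i 1 \<in> A} =
      (\<integral>\<^sup>+s. indicator ?W x * indicator A (x + (s - x$i) *\<^sub>R axis i 1) \<partial>lborel)"
      by (subst nn_integral_cmult) (auto simp: indicator_def)
  qed
  also have "\<dots> = (\<integral>\<^sup>+s. (\<integral>\<^sup>+x. indicator ?W x * indicator A (x + (s - x$i) *\<^sub>R axis i 1) \<partial>lborel) \<partial>lborel)"
    by (rule lborel_pair.Fubini') (measurable)
  also have "\<dots> = (\<integral>\<^sup>+s. emeasure lborel {x. 0 \<le> x$i \<and> x$i \<le> 1 \<and> x + (s - x$i) *\<^sub>R axis i 1 \<in> A} \<partial>lborel)"
  proof (rule nn_integral_cong)
    fix s :: real
    have "(\<integral>\<^sup>+x. indicator ?W x * indicator A (x + (s - x$i) *\<^sub>R axis i 1) \<partial>lborel) =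
      (\<integral>\<^sup>+x. indicator {x. 0 \<le> x$i \<and> x$i \<le> 1 \<and> x + (s - x$i) *\<^sub>R axis i 1 \<in> A} x \<partial>lborel)"
      by (intro nn_integral_cong) (auto simp: indicator_def)
    thus "(\<integral>\<^sup>+x. indicator ?W x * indicator A (x + (s - x$i) *\<^sub>R axis i 1) \<partial>lborel) =
      emeasure lborel {x. 0 \<le> x$i \<and> x$i \<le> 1 \<and> x + (s - x$i) *\<^sub>R axis i 1 \<in> A}"
      by simp
  qed
  finally show ?thesis .
qed

subsection \<open>Projections and Minkowski sums with cubes\<close>

text \<open>The product of the unit cube in the coordinates \<open>S\<close> with the projection of \<open>K\<close> to the
  others: projections of all dimensions can so be compared in one space and by one measure.\<close>
definition shadow :: "'d set \<Rightarrow> (real^'d) set \<Rightarrow> (real^'d::finite) set" where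
  "shadow S K = {x. (\<forall>i\<in>S. 0 \<le> x$i \<and> x$i \<le> 1) \<and> (\<exists>k\<in>K. \<forall>i. i \<notin> S \<longrightarrow> x$i = k$i)}"

text \<open>The Minkowski sum of \<open>K\<close> with the unit cube in the coordinates
  \<open>T\<close>. The parameter \<open>T\<close> allows induction over one direction at a
  time.\<close>

definition thicken :: "'d set \<Rightarrow> (real^'d) set \<Rightarrow> (real^'d::finite) set" where
  "thicken T K = {x. \<exists>k\<in>K. \<forall>i. if i \<in> T then k$i \<le> x$i \<and> x$i \<le> k$i + 1 else x$i = k$i}"

text \<open>Being a linear image of a product with the cube gives compactness and convexity;
  \<open>thicken_eq_image\<close> serves the same end.\<close>

lemma shadow_eq_image:
  "shadow S K = (\<lambda>p. \<chi> i. if i \<in> S then snd p $ i else fst p $ i) ` (K \<times> cbox 0 1)" (is "_ = ?f ` _")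
proof (intro set_eqI iffI)
  fix x assume "x \<in> shadow S K"
  then obtain k where k: "k \<in> K" "\<forall>i\<in>S. 0 \<le> x$i \<and> x$i \<le> 1" "\<forall>i. i \<notin> S \<longrightarrow> x$i = k$i"
    unfolding shadow_def by blast
  hence "x = ?f (k, \<chi> i. if i \<in> S then x$i else 0)" "(\<chi> i. if i \<in> S then x$i else 0) \<in> cbox 0 (1::real^'a)"
    by (auto simp: vec_eq_iff mem_box_cart)
  thus "x \<in> ?f ` (K \<times> cbox 0 1)" using k(1) by blast
next
  fix x assume "x \<in> ?f ` (K \<times> cbox 0 1)"
  then obtain k c where "k \<in> K" "c \<in> cbox 0 (1::real^'a)" "x = ?f (k, c)" by auto
  thus "x \<in> shadow S K" unfolding shadow_def by (auto simp: mem_box_cart intro!: bexI[of _ k])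
qed

lemma thicken_eq_image:
  "thicken T K = (\<lambda>p. \<chi> i. if i \<in> T then fst p $ i + snd p $ i else fst p $ i) ` (K \<times> cbox 0 1)" (is "_ = ?f ` _")
proof (intro set_eqI iffI)
  fix x assume "x \<in> thicken T K"
  then obtain k where k: "k \<in> K" and x: "\<And>i. if i \<in> T then k$i \<le> x$i \<and> x$i \<le> k$i + 1 else x$i = k$i"
    unfolding thicken_def by blast
  have "x $ i = ?f (k, x - k) $ i" for i
    using x[of i] by (auto split: if_splits)
  hence "x = ?f (k, x - k)" by (simp add: vec_eq_iff)
  moreover have "0 \<le> (x - k) $ i \<and> (x - k) $ i \<le> 1" for i
    using x[of i] by (auto split: if_splits)
  hence "x - k \<in> cbox 0 1" by (simp add: mem_box_cart)
  ultimately show "x \<in> ?f ` (K \<times> cbox 0 1)" using k by blast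
next
  fix x assume "x \<in> ?f ` (K \<times> cbox 0 1)"
  then obtain k c where "k \<in> K" "c \<in> cbox 0 (1::real^'a)" "x = ?f (k, c)" by auto
  thus "x \<in> thicken T K" unfolding thicken_def by (auto simp: mem_box_cart intro!: bexI[of _ k])
qed

lemma compact_shadow: "compact K \<Longrightarrow> compact (shadow S K)"
  unfolding shadow_eq_image
proof (intro compact_continuous_image compact_Times)
  show "continuous_on (K \<times> cbox 0 1) (\<lambda>p. \<chi> i. if i \<in> S then snd p $ i else fst p $ i)"
  proof (intro continuous_on_vec_lambda)
    fix i show "continuous_on (K \<times> cbox 0 1) (\<lambda>p. if i \<in> S then snd p $ i else fst p $ i)"
      by (cases "i \<in> S") (auto intro!: continuous_intros)
  qed
qed auto

lemma convex_shadow: "convex K \<Longrightarrow> convex (shadow S K)"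
  unfolding shadow_eq_image
proof (intro convex_linear_image convex_Times)
  show "linear (\<lambda>p. \<chi> i. if i \<in> S then snd p $ i else fst p $ i)"
    by (rule linearI) (auto simp: vec_eq_iff)
qed auto

lemma compact_thicken: "compact K \<Longrightarrow> compact (thicken T K)"
  unfolding thicken_eq_image
proof (intro compact_continuous_image compact_Times)
  show "continuous_on (K \<times> cbox 0 1) (\<lambda>p. \<chi> i. if i \<in> T then fst p $ i + snd p $ i else fst p $ i)"
  proof (intro continuous_on_vec_lambda)
    fix i show "continuous_on (K \<times> cbox 0 1) (\<lambda>p. if i \<in> T then fst p $ i + snd p $ i else fst p $ i)"
      by (cases "i \<in> T") (auto intro!: continuous_intros)
  qed
qed auto

lemma convex_thicken: "convex K \<Longrightarrow> convex (thicken T K)"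
  unfolding thicken_eq_image
proof (intro convex_linear_image convex_Times)
  show "linear (\<lambda>p. \<chi> i. if i \<in> T then fst p $ i + snd p $ i else fst p $ i)"
    by (rule linearI) (auto simp: vec_eq_iff algebra_simps)
qed auto

lemma shadow_mono: "K \<subseteq> L \<Longrightarrow> shadow S K \<subseteq> shadow S L"
  unfolding shadow_def by blast

lemma shadow_shadow: "shadow S (shadow T K) = shadow (S \<union> T) K"
proof (intro set_eqI iffI)
  fix x assume "x \<in> shadow (S \<union> T) K"
  then obtain k where k: "k \<in> K" "\<And>i. i \<in> S \<union> T \<Longrightarrow> 0 \<le> x$i \<and> x$i \<le> 1" "\<And>i. i \<notin> S \<union> T \<Longrightarrow> x$i = k$i"
    unfolding shadow_def by blast
  define y where "y = (\<chi> i. if i \<in> T then x$i else k$i)"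
  have "y \<in> shadow T K" unfolding shadow_def y_def using k(1,2) by auto
  moreover have "x$i = y$i" if "i \<notin> S" for i using that k(3) by (auto simp: y_def)
  ultimately show "x \<in> shadow S (shadow T K)" using k(2) unfolding shadow_def by blast
next
  fix x assume "x \<in> shadow S (shadow T K)"
  then obtain y k where "k \<in> K" "\<And>i. i \<in> S \<Longrightarrow> 0 \<le> x$i \<and> x$i \<le> 1" "\<And>i. i \<notin> S \<Longrightarrow> x$i = y$i"
    "\<And>i. i \<in> T \<Longrightarrow> 0 \<le> y$i \<and> y$i \<le> 1" "\<And>i. i \<notin> T \<Longrightarrow> y$i = k$i"
    unfolding shadow_def by blast
  thus "x \<in> shadow (S \<union> T) K" unfolding shadow_def
    by (intro CollectI conjI ballI bexI[of _ k]) (metis UnCI UnE)+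
qed

lemma shadow_empty [simp]: "shadow {} K = K"
  unfolding shadow_def by (auto simp: vec_eq_iff[symmetric])

lemma thicken_empty [simp]: "thicken {} K = K"
  unfolding thicken_def by (auto simp: vec_eq_iff[symmetric])

lemma thicken_insert:
  assumes "i \<notin> T"
  shows "thicken (insert i T) K = thicken {i} (thicken T K)"
proof (intro set_eqI iffI)
  fix x assume "x \<in> thicken (insert i T) K"
  then obtain k where k: "k \<in> K" and x: "\<And>j. if j \<in> insert i T then k$j \<le> x$j \<and> x$j \<le> k$j + 1 else x$j = k$j"
    unfolding thicken_def by blast
  define y where "y = (\<chi> j. if j = i then k$j else x$j)"
  have "y \<in> thicken T K" unfolding thicken_def y_def using k x assms
    by (auto intro!: bexI[of _ k] split: if_splits)
  moreover have "if j \<in> {i} then y$j \<le> x$j \<and> x$j \<le> y$j + 1 else x$j = y$j" for j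
    using x[of j] by (auto simp: y_def)
  ultimately show "x \<in> thicken {i} (thicken T K)" unfolding thicken_def by blast
next
  fix x assume "x \<in> thicken {i} (thicken T K)"
  then obtain k y where k: "k \<in> K" 
    and y: "\<And>j. if j \<in> T then k$j \<le> y$j \<and> y$j \<le> k$j + 1 else y$j = k$j"
    and x: "\<And>j. if j \<in> {i} then y$j \<le> x$j \<and> x$j \<le> y$j + 1 else x$j = y$j"
    unfolding thicken_def by blast
  have "if j \<in> insert i T then k$j \<le> x$j \<and> x$j \<le> k$j + 1 else x$j = k$j" for j
    using y[of j] x[of j] assms by (cases "j = i"; cases "j \<in> T") auto
  thus "x \<in> thicken (insert i T) K" using k unfolding thicken_def by blast
qed

text \<open>The two operations act on disjoint coordinates. This lets the induction hypothesis for
  \<open>T\<close> be applied to the body \<open>shadow {i} K\<close>.\<close>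

lemma shadow_thicken:
  assumes "i \<notin> T"
  shows "shadow {i} (thicken T K) = thicken T (shadow {i} K)"
proof (intro set_eqI iffI)
  fix x assume "x \<in> shadow {i} (thicken T K)"
  then obtain k y where k: "k \<in> K" 
    and y: "\<And>j. if j \<in> T then k$j \<le> y$j \<and> y$j \<le> k$j + 1 else y$j = k$j"
    and x: "0 \<le> x$i" "x$i \<le> 1" "\<And>j. j \<noteq> i \<Longrightarrow> x$j = y$j"
    unfolding thicken_def shadow_def by blast
  define k' where "k' = (\<chi> j. if j = i then x$j else k$j)"
  have "k' \<in> shadow {i} K" unfolding shadow_def k'_def using k x by auto
  moreover have "if j \<in> T then k'$j \<le> x$j \<and> x$j \<le> k'$j + 1 else x$j = k'$j" for j
    using y[of j] x(3)[of j] assms unfolding k'_def by (cases "j = i") auto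
  ultimately show "x \<in> thicken T (shadow {i} K)" unfolding thicken_def by blast
next
  fix x assume "x \<in> thicken T (shadow {i} K)"
  then obtain k k' where k: "k \<in> K" "0 \<le> k'$i" "k'$i \<le> 1" "\<And>j. j \<noteq> i \<Longrightarrow> k'$j = k$j"
    and x: "\<And>j. if j \<in> T then k'$j \<le> x$j \<and> x$j \<le> k'$j + 1 else x$j = k'$j"
    unfolding thicken_def shadow_def by blast
  define y where "y = (\<chi> j. if j = i then k$j else x$j)"
  have "if j \<in> T then k$j \<le> y$j \<and> y$j \<le> k$j + 1 else y$j = k$j" for j
    using x[of j] k(4)[of j] assms unfolding y_def by (cases "j = i") auto
  hence "y \<in> thicken T K" using k(1) unfolding thicken_def by blast
  moreover have "0 \<le> x$i" "x$i \<le> 1" using x[of i] k assms by auto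
  moreover have "x$j = y$j" if "j \<noteq> i" for j using that by (simp add: y_def)
  ultimately show "x \<in> shadow {i} (thicken T K)" unfolding shadow_def by blast
qed

section \<open>Fibres along an axis and the volume of a thickened body\<close>

lemma axis_fibre_interval:
  fixes K :: "(real^'d) set"
  assumes "compact K" "convex K"
  obtains a b where "{t. x + t *\<^sub>R axis i 1 \<in> K} = {a..b}"
proof -
  have "{t. x + t *\<^sub>R axis i 1 \<in> K} = (\<lambda>y. y$i - x$i) ` (K \<inter> {y. \<forall>j. j \<noteq> i \<longrightarrow> y$j = x$j})" (is "?F = ?G")
  proof (intro set_eqI iffI)
    fix t assume "t \<in> ?F"
    thus "t \<in> ?G" by (intro image_eqI[of _ _ "x + t *\<^sub>R axis i 1"]) (auto simp: axis_def)
  next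
    fix t assume "t \<in> ?G"
    then obtain y where y: "y \<in> K" "t = y$i - x$i" "\<And>j. j \<noteq> i \<Longrightarrow> y$j = x$j" by blast
    hence "y = x + t *\<^sub>R axis i 1" by (auto simp: vec_eq_iff axis_def)
    thus "t \<in> ?F" using y by simp
  qed
  moreover have "closed {y::real^'d. \<forall>j. j \<noteq> i \<longrightarrow> y$j = x$j}"
    by (intro closed_Collect_all closed_Collect_imp closed_Collect_eq continuous_intros) auto
  hence "compact ?G" using assms(1) by (intro compact_continuous_image compact_Int_closed continuous_intros)
  moreover have "convex ?F"
  proof (rule convexI)
    fix s t u v :: real assume *: "s \<in> ?F" "t \<in> ?F" "0 \<le> u" "0 \<le> v" "u + v = 1"
    hence "u *\<^sub>R (x + s *\<^sub>R axis i 1) + v *\<^sub>R (x + t *\<^sub>R axis i 1) \<in> K"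
      using convexD[OF assms(2)] by simp
    also have "u *\<^sub>R (x + s *\<^sub>R axis i 1) + v *\<^sub>R (x + t *\<^sub>R axis i 1) =
      (u + v) *\<^sub>R x + (u *\<^sub>R s + v *\<^sub>R t) *\<^sub>R axis i 1" by (simp add: algebra_simps)
    finally show "u *\<^sub>R s + v *\<^sub>R t \<in> ?F" using * by simp
  qed
  \<comment> \<open>An empty fibre is covered too, by an interval with \<open>b < a\<close>.\<close>
  ultimately have "\<exists>a b. ?F = {a..b}"
    by (intro connected_compact_interval_1[THEN iffD1] conjI convex_connected) simp_all
  thus ?thesis using that by blast
qed

lemma axis_fibre_empty_iff:
  assumes "0 \<le> x$i" "x$i \<le> 1"
  shows "{t. x + t *\<^sub>R axis i 1 \<in> K} \<noteq> {} \<longleftrightarrow> x \<in> shadow {i} K"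
proof
  assume "{t. x + t *\<^sub>R axis i 1 \<in> K} \<noteq> {}"
  then obtain t where "x + t *\<^sub>R axis i 1 \<in> K" by blast
  thus "x \<in> shadow {i} K" using assms
    unfolding shadow_def by (auto simp: axis_def intro!: bexI[of _ "x + t *\<^sub>R axis i 1"])
next
  assume "x \<in> shadow {i} K"
  then obtain k where k: "k \<in> K" "\<And>j. j \<noteq> i \<Longrightarrow> x$j = k$j" unfolding shadow_def by blast
  hence "x + (k$i - x$i) *\<^sub>R axis i 1 = k" by (auto simp: vec_eq_iff axis_def)
  thus "{t. x + t *\<^sub>R axis i 1 \<in> K} \<noteq> {}" using k(1) by (metis (mono_tags, lifting) empty_iff mem_Collect_eq)
qed

text \<open>Every nonempty fibre in direction \<open>i\<close> is an interval and grows by exactly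
  1, while empty fibres stay empty. The gain is therefore the integral of 1 over the base points
  with nonempty fibre, and these form the shadow.\<close>

lemma emeasure_thicken_axis:
  fixes K :: "(real^'d) set"
  assumes K: "compact K" "convex K"
  shows "emeasure lborel (thicken {i} K) = emeasure lborel K + emeasure lborel (shadow {i} K)"
proof -
  let ?W = "{x::real^'d. 0 \<le> x$i \<and> x$i \<le> 1}"
  have [measurable]: "K \<in> sets borel" "thicken {i} K \<in> sets borel" "shadow {i} K \<in> sets borel"
    using K compact_thicken compact_shadow compact_imp_closed borel_closed by metis+
  have "emeasure lborel (thicken {i} K) =
    (\<integral>\<^sup>+x. indicator ?W x * emeasure lborel {t. x + t *\<^sub>R axis i 1 \<in> K} + indicator (shadow {i} K) x \<partial>lborel)"
    unfolding emeasure_axis_slices[OF \<open>thicken {i} K \<in> sets borel\<close>, of i]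
  proof (rule nn_integral_cong)
    fix x :: "real^'d"
    show "indicator ?W x * emeasure lborel {t. x + t *\<^sub>R axis i 1 \<in> thicken {i} K} =
       indicator ?W x * emeasure lborel {t. x + t *\<^sub>R axis i 1 \<in> K} + indicator (shadow {i} K) x"
    proof (cases "x \<in> shadow {i} K")
      case False
      have "{t. x + t *\<^sub>R axis i 1 \<in> K} = {}" if "x \<in> ?W"
        using that False axis_fibre_empty_iff[of x i K] by auto
      moreover have "{t. x + t *\<^sub>R axis i 1 \<in> thicken {i} K} = {}" if "x \<in> ?W"
      proof -
        have "x \<notin> shadow {i} (thicken {i} K)" using False unfolding shadow_def thicken_def by fastforce
        thus ?thesis using that axis_fibre_empty_iff[of x i "thicken {i} K"] by auto
      qed
      ultimately show ?thesis using False by (auto simp: indicator_def)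
    next
      case True
      hence W: "x \<in> ?W" unfolding shadow_def by auto
      obtain a b where ab: "{t. x + t *\<^sub>R axis i 1 \<in> K} = {a..b}"
        using axis_fibre_interval K by metis
      hence "a \<le> b" using axis_fibre_empty_iff[of x i K] True W by auto
      have "{t. x + t *\<^sub>R axis i 1 \<in> thicken {i} K} = {a..b+1}"
      proof (intro set_eqI iffI)
        fix t assume "t \<in> {t. x + t *\<^sub>R axis i 1 \<in> thicken {i} K}"
        then obtain k where k: "k \<in> K" "k$i \<le> x$i + t" "x$i + t \<le> k$i + 1" "\<And>j. j \<noteq> i \<Longrightarrow> x$j = k$j"
          unfolding thicken_def by (auto simp: axis_def split: if_splits)
        have "x + (k$i - x$i) *\<^sub>R axis i 1 = k" using k by (auto simp: vec_eq_iff axis_def)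
        hence "k$i - x$i \<in> {a..b}" unfolding ab[symmetric] using k(1) by simp
        thus "t \<in> {a..b+1}" using k by auto
      next
        fix t assume t: "t \<in> {a..b+1}"
        \<comment> \<open>The highest point of the old fibre that is not above \<open>t\<close>; it
          is at most 1 below \<open>t\<close> because \<open>t \<le> b + 1\<close>.\<close>
        define s where "s = min t b"
        have "s \<in> {a..b}" using t \<open>a \<le> b\<close> by (auto simp: s_def)
        hence "x + s *\<^sub>R axis i 1 \<in> K" using ab by blast
        moreover have "s \<le> t" "t \<le> s + 1" using t by (auto simp: s_def)
        ultimately show "t \<in> {t. x + t *\<^sub>R axis i 1 \<in> thicken {i} K}"
          unfolding thicken_def by (auto simp: axis_def intro!: bexI[of _ "x + s *\<^sub>R axis i 1"])
      qed
      moreover have "ennreal (b + 1 - a) = ennreal (b - a) + 1"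
        using ennreal_plus[of "b - a" 1] \<open>a \<le> b\<close> by (simp add: add_diff_eq algebra_simps)
      ultimately show ?thesis using True W ab \<open>a \<le> b\<close> by simp
    qed
  qed
  also have "\<dots> = emeasure lborel K + emeasure lborel (shadow {i} K)"
    unfolding emeasure_axis_slices[OF \<open>K \<in> sets borel\<close>, of i]
    by (subst nn_integral_add) auto
  finally show ?thesis .
qed

text \<open>Each direction of \<open>T\<close> contributes a choice between keeping the body and
  replacing it by its shadow, so iterating the one-direction formula expands like a product of
  binomials into a sum over subsets.\<close>

lemma emeasure_thicken:
  fixes K :: "(real^'d) set"
  assumes "compact K" "convex K"
  shows "emeasure lborel (thicken T K) = (\<Sum>S\<in>Pow T. emeasure lborel (shadow S K))"
  using finite[of T] assms
proof (induction T arbitrary: K)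
  case (insert i T)
  have "emeasure lborel (thicken (insert i T) K) =
    emeasure lborel (thicken T K) + emeasure lborel (thicken T (shadow {i} K))"
    using emeasure_thicken_axis[OF compact_thicken convex_thicken, OF insert.prems] insert.hyps
    by (simp add: thicken_insert[of i T] shadow_thicken)
  also have "\<dots> = (\<Sum>S\<in>Pow T. emeasure lborel (shadow S K)) + (\<Sum>S\<in>Pow T. emeasure lborel (shadow S (shadow {i} K)))"
    using insert.IH[OF insert.prems] insert.IH[OF compact_shadow convex_shadow, OF insert.prems] by simp
  also have "(\<Sum>S\<in>Pow T. emeasure lborel (shadow S (shadow {i} K))) = (\<Sum>S\<in>insert i ` Pow T. emeasure lborel (shadow S K))"
    using insert.hyps by (subst sum.reindex) (auto simp: shadow_shadow inj_on_def)
  also have "(\<Sum>S\<in>Pow T. emeasure lborel (shadow S K)) + \<dots> = (\<Sum>S\<in>Pow (insert i T). emeasure lborel (shadow S K))"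
    unfolding Pow_insert using insert.hyps by (subst sum.union_disjoint) auto
  finally show ?case .
qed simp

subsection \<open>Moving a point along an axis\<close>

text \<open>Up to the unit cube in the coordinates \<open>S\<close>, a pyramid of height 1 in direction \<open>i\<close> over the
  projection of \<open>K\<close> along \<open>i\<close>, with apex above \<open>p\<close>.\<close>
definition apex_cone :: "'d set \<Rightarrow> 'd \<Rightarrow> real^'d \<Rightarrow> (real^'d) set \<Rightarrow> (real^'d::finite) set" where
  "apex_cone S i p K = {x. (\<forall>j\<in>insert i S. 0 \<le> x$j \<and> x$j \<le> 1) \<and>
     (\<exists>u\<in>K. \<forall>j. j \<notin> insert i S \<longrightarrow> x$j = (1 - x$i) * u$j + x$i * p$j)}"

lemma compact_apex_cone:
  fixes K :: "(real^'d) set"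
  assumes "compact K"
  shows "compact (apex_cone S i p K)"
proof -
  let ?f = "\<lambda>q::((real \<times> (real^'d)) \<times> (real^'d)). \<chi> j. if j = i then fst (fst q) else if j \<in> S then snd q $ j
    else (1 - fst (fst q)) * snd (fst q) $ j + fst (fst q) * p$j"
  have "apex_cone S i p K = ?f ` (({0..1} \<times> K) \<times> cbox 0 1)"
  proof (intro set_eqI iffI)
    fix x assume "x \<in> apex_cone S i p K"
    then obtain u where u: "u \<in> K" "\<And>j. j \<in> insert i S \<Longrightarrow> 0 \<le> x$j \<and> x$j \<le> 1"
      "\<And>j. j \<notin> insert i S \<Longrightarrow> x$j = (1 - x$i) * u$j + x$i * p$j" unfolding apex_cone_def by blast
    let ?c = "\<chi> j. if j \<in> S then x$j else (0::real)"
    have "x = ?f ((x$i, u), ?c)" using u(3) by (auto simp: vec_eq_iff)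
    moreover have "?c \<in> cbox 0 1" using u(2) by (auto simp: mem_box_cart)
    moreover have "x$i \<in> {0..1}" using u(2) by simp
    ultimately show "x \<in> ?f ` (({0..1} \<times> K) \<times> cbox 0 1)" using u(1) by blast
  next
    fix x assume "x \<in> ?f ` (({0..1} \<times> K) \<times> cbox 0 1)"
    then obtain s u c where "s \<in> {0..1}" "u \<in> K" "c \<in> cbox 0 (1::real^'d)" "x = ?f ((s, u), c)" by auto
    thus "x \<in> apex_cone S i p K" unfolding apex_cone_def by (auto simp: mem_box_cart intro!: bexI[of _ u])
  qed
  moreover have "continuous_on X ?f" for X
  proof (intro continuous_on_vec_lambda)
    fix j show "continuous_on X (\<lambda>q. if j = i then fst (fst q) else if j \<in> S then snd q $ j
      else (1 - fst (fst q)) * snd (fst q) $ j + fst (fst q) * p$j)"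
      by (cases "j = i"; cases "j \<in> S") (auto intro!: continuous_intros)
  qed
  ultimately show ?thesis using assms by (auto intro!: compact_continuous_image compact_Times)
qed

lemma emeasure_compact_eq_measure: "compact A \<Longrightarrow> emeasure lborel A = ennreal (measure lborel A)"
  using emeasure_bounded_finite[OF compact_imp_bounded, of A]
  by (intro emeasure_eq_ennreal_measure) auto

text \<open>Slicing is done with \<open>lborel\<close>, whereas the theorem and the stretching lemma
  speak of \<open>lebesgue\<close>; the bodies to be compared are compact, and there both
  agree.\<close>

lemma measure_lebesgue_compact: "compact A \<Longrightarrow> measure lebesgue A = measure lborel A"
  using compact_imp_closed[of A] by (intro measure_completion) auto

lemma nn_integral_one_minus_power:
  assumes "0 \<le> v"
  shows "(\<integral>\<^sup>+s. ennreal ((1 - s) ^ k * v) * indicator {0..1} s \<partial>lborel) = ennreal (v / (real k + 1))"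
proof -
  let ?C = "- v / (real k + 1)"
  have "(\<integral>\<^sup>+s. ennreal ((1 - s) ^ k * v) * indicator {0..1} s \<partial>lborel) =
     ennreal ((1 - 1) ^ Suc k * ?C - (1 - 0) ^ Suc k * ?C)"
  proof (rule nn_integral_FTC_Icc)
    fix s :: real
    have der: "((\<lambda>s. (1 - s) ^ Suc k) has_real_derivative - (real k + 1) * (1 - s) ^ k) (at s)"
      by (auto intro!: derivative_eq_intros simp del: power_Suc simp: algebra_simps)
    have "- a * q * (- v / a) = q * v" if "a \<noteq> 0" for a q :: real
      using that by simp
    hence eq: "- (real k + 1) * (1 - s) ^ k * ?C = (1 - s) ^ k * v"
      by (metis of_nat_Suc add.commute of_nat_0_eq_iff nat.distinct(2))
    show "((\<lambda>s. (1 - s) ^ Suc k * ?C) has_real_derivative (1 - s) ^ k * v) (at s)"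
      unfolding eq[symmetric] using der by (rule DERIV_cmult_right)
  qed (use assms in auto)
  thus ?thesis by simp
qed

text \<open>The slice at height \<open>s\<close> is the base scaled by \<open>1 - s\<close> in its k
  free coordinates and moved towards the apex, so its volume is (1 - s)^k times that of the base.
  Integrating over [0,1] gives the factor 1/(k + 1).\<close>

lemma emeasure_apex_cone:
  fixes K :: "(real^'d) set"
  assumes K: "compact K"
  shows "emeasure lborel (apex_cone S i p K) =
    ennreal (measure lborel (shadow (insert i S) K) / (real (card (- insert i S)) + 1))"
proof -
  let ?I = "insert i S" and ?v = "measure lborel (shadow (insert i S) K)"
  \<comment> \<open>Scaling factors and translation of the slice: the cube coordinates, including
    the freed coordinate \<open>i\<close>, are left alone.\<close>
  define m where "m s j = (if j \<in> ?I then 1 else 1 - s)" for s :: real and j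
  define b where "b s = (\<chi> j. if j \<in> ?I then 0 else s * p$j)" for s :: real
  have slice: "{x. 0 \<le> x$i \<and> x$i \<le> 1 \<and> x + (s - x$i) *\<^sub>R axis i 1 \<in> apex_cone S i p K} =
    (+) (b s) ` (\<lambda>x. \<chi> j. m s j * x$j) ` shadow ?I K" (is "?L = ?R") if s: "s \<in> {0..1}" for s
  proof (intro set_eqI iffI)
    fix x assume "x \<in> ?L"
    then obtain u where "u \<in> K" "0 \<le> x$i" "x$i \<le> 1"
        "\<forall>j\<in>?I. 0 \<le> (x + (s - x$i) *\<^sub>R axis i 1)$j \<and> (x + (s - x$i) *\<^sub>R axis i 1)$j \<le> 1"
      "\<forall>j. j \<notin> ?I \<longrightarrow> (x + (s - x$i) *\<^sub>R axis i 1)$j =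
        (1 - (x + (s - x$i) *\<^sub>R axis i 1)$i) * u$j + (x + (s - x$i) *\<^sub>R axis i 1)$i * p$j"
      unfolding apex_cone_def by blast
    hence u: "u \<in> K" "0 \<le> x$i" "x$i \<le> 1" "j \<in> S \<Longrightarrow> j \<noteq> i \<Longrightarrow> 0 \<le> x$j \<and> x$j \<le> 1"
      "j \<notin> ?I \<Longrightarrow> x$j = (1 - s) * u$j + s * p$j" for j
      by (auto simp: axis_def)
    define y where "y = (\<chi> j. if j \<in> ?I then x$j else u$j)"
    have "y \<in> shadow ?I K" unfolding shadow_def y_def using u by auto
    moreover have "x = b s + (\<chi> j. m s j * y$j)" 
      using u(5) by (auto simp: vec_eq_iff b_def m_def y_def)
    ultimately show "x \<in> ?R" by blast
  next
    fix x assume "x \<in> ?R"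
    then obtain y where y: "y \<in> shadow ?I K" and x: "x = b s + (\<chi> j. m s j * y$j)" by blast
    obtain u where "u \<in> K" "\<And>j. j \<notin> ?I \<Longrightarrow> y$j = u$j" "\<And>j. j \<in> ?I \<Longrightarrow> 0 \<le> y$j \<and> y$j \<le> 1"
      using y unfolding shadow_def by blast
    thus "x \<in> ?L" using s unfolding apex_cone_def x
      by (auto simp: axis_def b_def m_def intro!: bexI[of _ u])
  qed
  have empty: "{x. 0 \<le> x$i \<and> x$i \<le> 1 \<and> x + (s - x$i) *\<^sub>R axis i 1 \<in> apex_cone S i p K} = {}" if "s \<notin> {0..1}" for s
    using that unfolding apex_cone_def by (auto simp: axis_def)
  have prod_m: "\<bar>prod (m s) UNIV\<bar> = (1 - s) ^ card (- ?I)" if "s \<in> {0..1}" for s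
  proof -
    have "prod (m s) UNIV = (\<Prod>j\<in>- ?I. 1 - s)"
      by (intro prod.mono_neutral_cong_right) (auto simp: m_def)
    thus ?thesis using that by simp
  qed
  have meas: "emeasure lborel {x. 0 \<le> x$i \<and> x$i \<le> 1 \<and> x + (s - x$i) *\<^sub>R axis i 1 \<in> apex_cone S i p K} =
     ennreal ((1 - s) ^ card (- ?I) * ?v) * indicator {0..1} s" for s
  proof (cases "s \<in> {0..1}")
    case True
    have c: "compact (shadow ?I K)" using K by (rule compact_shadow)
    have cm: "compact ((\<lambda>x. \<chi> j. m s j * x$j) ` shadow ?I K)"
      by (intro compact_continuous_image c continuous_on_vec_lambda continuous_intros)
    hence c2: "compact ((+) (b s) ` (\<lambda>x. \<chi> j. m s j * x$j) ` shadow ?I K)"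
      by (rule compact_translation)
    have "measure lebesgue ((+) (b s) ` (\<lambda>x. \<chi> j. m s j * x$j) ` shadow ?I K) = (1 - s) ^ card (- ?I) * ?v"
      using measure_stretch[OF lmeasurable_compact[OF c], of "m s"] prod_m[OF True] c
      by (simp add: measure_translation measure_lebesgue_compact)
    thus ?thesis unfolding slice[OF True]
      using c2 True by (simp add: emeasure_compact_eq_measure measure_lebesgue_compact)
  qed (simp add: empty)
  have borel: "apex_cone S i p K \<in> sets borel" using compact_apex_cone[OF K] by (intro borel_closed compact_imp_closed)
  show ?thesis
    unfolding emeasure_coordinate_slices[OF borel, of i] meas
    by (simp add: nn_integral_one_minus_power)
qed

lemma emeasure_affine_preimage:
  fixes G :: "real set"
  assumes [measurable]: "G \<in> sets borel" and c: "c \<noteq> 0"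
  shows "emeasure lborel {t. (t - b) / c \<in> G} = ennreal \<bar>c\<bar> * emeasure lborel G"
proof -
  have "emeasure lborel {t. (t - b) / c \<in> G} = (\<integral>\<^sup>+t. indicator {t. (t - b) / c \<in> G} t \<partial>lborel)"
    by simp
  also have "\<dots> = ennreal \<bar>c\<bar> * (\<integral>\<^sup>+t. indicator {t. (t - b) / c \<in> G} (b + c * t) \<partial>lborel)"
    using c by (intro nn_integral_real_affine) auto
  also have "(\<integral>\<^sup>+t. indicator {t. (t - b) / c \<in> G} (b + c * t) \<partial>lborel) = (\<integral>\<^sup>+t. indicator G t \<partial>lborel)"
    using c by (intro nn_integral_cong) (auto simp: indicator_def)
  finally show ?thesis by simp
qed

text \<open>Moving \<open>p \<in> K\<close> by \<open>c\<close> in direction \<open>i\<close> lengthens the fibre of \<open>K\<close> over a point \<open>y\<close>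
  of the projection at one end only, by at most \<open>\<bar>c\<bar>\<close> times the largest \<open>s\<close> such that \<open>y\<close> lies in
  the copy of the projection shrunk by \<open>1 - s\<close> towards \<open>p\<close>.\<close>
lemma emeasure_shadow_hull_insert:
  fixes K :: "(real^'d) set"
  assumes K: "compact K" "convex K" and p: "p \<in> K" and i: "i \<notin> S" and c: "c \<noteq> 0"
  shows "emeasure lborel (shadow S (convex hull (insert (p + c *\<^sub>R axis i 1) K)))
    \<le> emeasure lborel (shadow S K) + ennreal \<bar>c\<bar> * emeasure lborel (apex_cone S i p K)"
proof -
  define q where "q = p + c *\<^sub>R axis i 1"
  define H where "H = convex hull (insert q K)"
  let ?e = "axis i 1 :: real^'d"
  have H: "compact H" "convex H" unfolding H_def using K by (auto intro!: compact_convex_hull)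
  have borel [measurable]: "shadow S K \<in> sets borel" "shadow S H \<in> sets borel" "apex_cone S i p K \<in> sets borel"
    using K H compact_shadow compact_apex_cone compact_imp_closed borel_closed by metis+
  have fibre: "emeasure lborel {t. x + t *\<^sub>R ?e \<in> shadow S H} \<le>
    emeasure lborel {t. x + t *\<^sub>R ?e \<in> shadow S K} + ennreal \<bar>c\<bar> * emeasure lborel {t. x + t *\<^sub>R ?e \<in> apex_cone S i p K}" for x
  proof -
    let ?F = "{t. x + t *\<^sub>R ?e \<in> shadow S K}" and ?F2 = "{t. x + t *\<^sub>R ?e \<in> shadow S H}"
      and ?G = "{t. x + t *\<^sub>R ?e \<in> apex_cone S i p K}"
    have [measurable]: "?F \<in> sets borel" "?F2 \<in> sets borel" "?G \<in> sets borel" by measurable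
    obtain a b where F: "?F = {a..b}" using axis_fibre_interval[OF compact_shadow convex_shadow] K by metis
    \<comment> \<open>A point of the enlarged hull is l q + (1 - l) k with k in \<open>K\<close>.
      Replacing q by \<open>p\<close> gives a point of \<open>K\<close> on the same fibre, displaced
      by \<open>c * l\<close>; the remaining coordinates show that \<open>x\<close> lies over the
      copy of the projection shrunk by 1 - l towards \<open>p\<close>.\<close>
    have new: "\<exists>l k. k \<in> K \<and> 0 \<le> l \<and> l \<le> 1 \<and> t - c * l \<in> ?F \<and> (\<forall>j\<in>S. 0 \<le> x$j \<and> x$j \<le> 1) \<and>
        (\<forall>j. j \<notin> insert i S \<longrightarrow> x$j = (1 - l) * k$j + l * p$j)"
      if t: "t \<in> ?F2" for t
    proof -
      obtain w where w: "w \<in> H" "\<forall>j\<in>S. 0 \<le> (x + t *\<^sub>R ?e)$j \<and> (x + t *\<^sub>R ?e)$j \<le> 1"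
          "\<forall>j. j \<notin> S \<longrightarrow> (x + t *\<^sub>R ?e)$j = w$j"
        using t unfolding shadow_def by blast
      have cube: "\<forall>j\<in>S. 0 \<le> x$j \<and> x$j \<le> 1"
      proof
        fix j assume "j \<in> S"
        moreover from this have "j \<noteq> i" using i by auto
        ultimately show "0 \<le> x$j \<and> x$j \<le> 1" using w(2) by (auto simp: axis_def)
      qed
      have "K \<noteq> {}" using p by auto
      then obtain l m k where lm: "0 \<le> l" "0 \<le> m" "l + m = 1" "k \<in> K" "w = l *\<^sub>R q + m *\<^sub>R k"
        using w(1) K(2) unfolding H_def by (auto simp: convex_hull_insert hull_same)
      hence m: "m = 1 - l" by simp
      define v where "v = l *\<^sub>R p + m *\<^sub>R k"
      have "v \<in> K" unfolding v_def using K(2) p lm by (intro convexD) auto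
      moreover have wv: "w = v + (c * l) *\<^sub>R ?e" unfolding lm(5) v_def q_def by (simp add: algebra_simps)
      ultimately have "t - c * l \<in> ?F"
        unfolding shadow_def using w(3) cube i by (auto simp: axis_def intro!: bexI[of _ v])
      moreover have "\<forall>j. j \<notin> insert i S \<longrightarrow> x$j = (1 - l) * k$j + l * p$j"
        using w(3) unfolding wv v_def m by (auto simp: axis_def)
      ultimately show ?thesis using lm cube by (intro exI[of _ l] exI[of _ k]) auto
    qed
    \<comment> \<open>The end of the old fibre at which a move by \<open>c\<close> can lengthen
      it.\<close>
    define e where "e = (if c > 0 then b else a)"
    \<comment> \<open>The affine map rescales the overshoot beyond \<open>e\<close> by
      \<open>c\<close> and shifts it so that it lands in the fibre of the pyramid; undoing the
      scaling yields the factor \<open>\<bar>c\<bar>\<close>.\<close>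
    have "?F2 \<subseteq> ?F \<union> {t. (t - (e + c * x$i)) / c \<in> ?G}"
    proof
      fix t assume "t \<in> ?F2"
      then obtain l k where k: "k \<in> K" "0 \<le> l" "l \<le> 1" "t - c * l \<in> {a..b}" "\<forall>j\<in>S. 0 \<le> x$j \<and> x$j \<le> 1"
        "\<forall>j. j \<notin> insert i S \<longrightarrow> x$j = (1 - l) * k$j + l * p$j"
        using new[of t] unfolding F by blast
      show "t \<in> ?F \<union> {t. (t - (e + c * x$i)) / c \<in> ?G}"
      proof (cases "t \<in> ?F")
        case False
        \<comment> \<open>The overshoot in units of \<open>c\<close>. It is at most
          \<open>l\<close>, since going back by \<open>c * l\<close> returns to the old
          fibre.\<close>
        define s where "s = (t - e) / c"
        have s: "0 < s \<and> s \<le> l"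
        proof (cases "c > 0")
          case True
          moreover have "0 \<le> c * l" using True k by simp
          ultimately show ?thesis using k(4) False unfolding F s_def e_def
            by (auto simp: field_simps)
        next
          case neg: False
          hence "c < 0" using c by simp
          moreover from this have "c * l \<le> 0" using k by (simp add: mult_nonpos_nonneg)
          ultimately show ?thesis using k(4) False unfolding F s_def e_def
            by (auto simp: field_simps)
        qed
        have "\<exists>u\<in>K. \<forall>j. j \<notin> insert i S \<longrightarrow> x$j = (1 - s) * u$j + s * p$j"
        proof (cases "s = 1")
          case True
          hence "l = 1" using s k by auto
          thus ?thesis using k True p by (intro bexI[of _ p]) auto
        next
          case ne: False
          hence "s < 1" using s k by auto
          \<comment> \<open>The copies of \<open>K\<close> shrunk towards \<open>p\<close> are
            nested: since \<open>s \<le> l\<close>, the point (1 - l) k + l p can be rewritten as (1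
            - s) u + s p, with \<open>u\<close> between \<open>k\<close> and \<open>p\<close>. The
            excluded case \<open>s = 1\<close> is the apex itself.\<close>
          define u where "u = ((1 - l) / (1 - s)) *\<^sub>R k + ((l - s) / (1 - s)) *\<^sub>R p"
          have "u \<in> K" unfolding u_def using \<open>s < 1\<close> s k K(2) p
            by (intro convexD) (auto simp: divide_simps)
          moreover have "(1 - s) * u$j + s * p$j = (1 - l) * k$j + l * p$j" for j
          proof -
            have "(1 - s) * u$j = (1 - l) * k$j + (l - s) * p$j"
              unfolding u_def using \<open>s < 1\<close> by (simp add: distrib_left)
            thus ?thesis by (simp add: algebra_simps)
          qed
          ultimately show ?thesis using k(6) by metis
        qed
        hence "s - x$i \<in> ?G" unfolding apex_cone_def
          using s k(3,5) i by (auto simp: axis_def)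
        moreover have "(t - (e + c * x$i)) / c = s - x$i" unfolding s_def using c by (simp add: field_simps)
        ultimately show ?thesis by simp
      qed simp
    qed
    hence "emeasure lborel ?F2 \<le> emeasure lborel (?F \<union> {t. (t - (e + c * x$i)) / c \<in> ?G})"
      by (intro emeasure_mono) auto
    also have "\<dots> \<le> emeasure lborel ?F + emeasure lborel {t. (t - (e + c * x$i)) / c \<in> ?G}"
      by (intro emeasure_subadditive) auto
    also have "emeasure lborel {t. (t - (e + c * x$i)) / c \<in> ?G} = ennreal \<bar>c\<bar> * emeasure lborel ?G"
      using c by (intro emeasure_affine_preimage) auto
    finally show ?thesis .
  qed
  let ?W = "{x::real^'d. 0 \<le> x$i \<and> x$i \<le> 1}"
  have "emeasure lborel (shadow S H) \<le> (\<integral>\<^sup>+x. indicator ?W x * emeasure lborel {t. x + t *\<^sub>R ?e \<in> shadow S K} +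
    ennreal \<bar>c\<bar> * (indicator ?W x * emeasure lborel {t. x + t *\<^sub>R ?e \<in> apex_cone S i p K}) \<partial>lborel)"
    unfolding emeasure_axis_slices[OF borel(2), of i]
    by (intro nn_integral_mono) (use fibre in \<open>auto simp: indicator_def\<close>)
  also have "\<dots> = emeasure lborel (shadow S K) + ennreal \<bar>c\<bar> * emeasure lborel (apex_cone S i p K)"
    unfolding emeasure_axis_slices[OF borel(1), of i] emeasure_axis_slices[OF borel(3), of i]
    by (simp add: nn_integral_add nn_integral_cmult)
  finally show ?thesis unfolding H_def q_def .
qed

lemma measure_shadow_hull_insert:
  fixes K :: "(real^'d) set"
  assumes K: "compact K" "convex K" and p: "p \<in> K" and i: "i \<notin> S" and c: "c \<noteq> 0"
  shows "measure lborel (shadow S (convex hull (insert (p + c *\<^sub>R axis i 1) K)))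
    \<le> measure lborel (shadow S K) + \<bar>c\<bar> * measure lborel (shadow (insert i S) K) / card (- S)"
proof -
  \<comment> \<open>The base of the pyramid has one free coordinate fewer than \<open>- S\<close>,
    so the divisor k + 1 of its volume is \<open>card (- S)\<close>.\<close>
  have "- S = insert i (- insert i S)" using i by auto
  hence card: "card (- S) = Suc (card (- insert i S))" by (metis Compl_iff card_insert_disjoint finite_code insertI1)
  let ?H = "convex hull (insert (p + c *\<^sub>R axis i 1) K)"
  have "compact (shadow S ?H)"
    using K by (intro compact_shadow compact_convex_hull) auto
  hence "ennreal (measure lborel (shadow S ?H)) = emeasure lborel (shadow S ?H)"
    by (simp add: emeasure_compact_eq_measure)
  also have "\<dots> \<le> emeasure lborel (shadow S K) + ennreal \<bar>c\<bar> * emeasure lborel (apex_cone S i p K)"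
    using assms by (rule emeasure_shadow_hull_insert)
  also have "\<dots> = ennreal (measure lborel (shadow S K) + \<bar>c\<bar> * (measure lborel (shadow (insert i S) K) / card (- S)))"
    unfolding emeasure_apex_cone[OF K(1)] emeasure_compact_eq_measure[OF compact_shadow[OF K(1)]] card
    by (subst ennreal_plus, simp, simp, subst ennreal_mult) (simp_all add: add.commute)
  finally have "ennreal (measure lborel (shadow S ?H)) \<le>
    ennreal (measure lborel (shadow S K) + \<bar>c\<bar> * (measure lborel (shadow (insert i S) K) / card (- S)))" .
  thus ?thesis by (subst (asm) ennreal_le_iff) auto
qed

subsection \<open>Distributing steps over the directions\<close>

text \<open>The volume bound as a function of the numbers of steps. The index type is arbitrary
  because steps are indexed by the coordinate type \<open>'d\<close>, but the floors of the theorem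
  by \<open>{1..d}\<close>.\<close>

definition weight :: "'a set \<Rightarrow> ('a \<Rightarrow> nat) \<Rightarrow> real" where
  "weight A a = (\<Sum>I\<in>Pow A. (\<Prod>i\<in>I. real (a i)) / fact (card I))"

definition balanced :: "'a set \<Rightarrow> ('a \<Rightarrow> nat) \<Rightarrow> bool" where
  "balanced A a \<longleftrightarrow> (\<forall>i\<in>A. \<forall>j\<in>A. a i \<le> a j + 1)"

lemma sum_Pow_insert:
  assumes "finite A" "i \<notin> A"
  shows "(\<Sum>I\<in>Pow (insert i A). f I) = (\<Sum>I\<in>Pow A. f I + f (insert i I))"
proof -
  have "inj_on (insert i) (Pow A)" using assms(2) by (auto simp: inj_on_def)
  moreover have "Pow A \<inter> insert i ` Pow A = {}" using assms(2) by auto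
  ultimately show ?thesis using assms(1)
    by (simp add: Pow_insert sum.union_disjoint sum.reindex sum.distrib)
qed

text \<open>For fixed \<open>a i + a j\<close> the weight increases with \<open>a i * a j\<close>.\<close>
lemma weight_two:
  assumes B: "finite B" "i \<notin> B" "j \<notin> B" "i \<noteq> j"
  shows "weight (insert i (insert j B)) a = (\<Sum>J\<in>Pow B. (\<Prod>k\<in>J. real (a k)) *
    (1 / fact (card J) + (real (a i) + real (a j)) / fact (card J + 1) + real (a i) * real (a j) / fact (card J + 2)))"
proof -
  have "weight (insert i (insert j B)) a = (\<Sum>J\<in>Pow B. (\<Prod>k\<in>J. real (a k)) / fact (card J)
     + (\<Prod>k\<in>insert i J. real (a k)) / fact (card (insert i J))
     + ((\<Prod>k\<in>insert j J. real (a k)) / fact (card (insert j J))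
     + (\<Prod>k\<in>insert i (insert j J). real (a k)) / fact (card (insert i (insert j J)))))"
    unfolding weight_def using B by (simp add: sum_Pow_insert)
  also have "\<dots> = (\<Sum>J\<in>Pow B. (\<Prod>k\<in>J. real (a k)) *
    (1 / fact (card J) + (real (a i) + real (a j)) / fact (card J + 1) + real (a i) * real (a j) / fact (card J + 2)))"
  proof (intro sum.cong refl)
    fix J assume "J \<in> Pow B"
    hence J: "finite J" "i \<notin> J" "j \<notin> J" using B finite_subset by auto
    show "(\<Prod>k\<in>J. real (a k)) / fact (card J)
     + (\<Prod>k\<in>insert i J. real (a k)) / fact (card (insert i J))
     + ((\<Prod>k\<in>insert j J. real (a k)) / fact (card (insert j J))
     + (\<Prod>k\<in>insert i (insert j J). real (a k)) / fact (card (insert i (insert j J)))) =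
      (\<Prod>k\<in>J. real (a k)) *
    (1 / fact (card J) + (real (a i) + real (a j)) / fact (card J + 1) + real (a i) * real (a j) / fact (card J + 2))"
      using J B(4) by (simp add: ring_distribs add_divide_distrib mult_ac del: fact_Suc)
  qed
  finally show ?thesis .
qed

text \<open>In the form given by \<open>weight_two\<close> only the product of the two entries
  changes. With \<open>a i\<close> = x + 1 and \<open>a j\<close> = y it goes from (x + 1) y to x (y
  + 1), a gain of x - y.\<close>

lemma weight_move:
  assumes A: "finite A" "i \<in> A" "j \<in> A" and ij: "a j + 2 \<le> a i"
  shows "weight A a \<le> weight A (a(i := a i - 1, j := a j + 1))"
proof -
  define B where "B = A - {i, j}"
  have "i \<noteq> j" using ij by auto
  hence B: "A = insert i (insert j B)" "finite B" "i \<notin> B" "j \<notin> B" using A by (auto simp: B_def)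
  let ?a = "a(i := a i - 1, j := a j + 1)"
  show ?thesis unfolding B(1) weight_two[OF B(2-4) \<open>i \<noteq> j\<close>]
  proof (intro sum_mono)
    fix J assume "J \<in> Pow B"
    hence J: "(\<Prod>k\<in>J. real (?a k)) = (\<Prod>k\<in>J. real (a k))" using B by (intro prod.cong) auto
    have s: "real (?a i) + real (?a j) = real (a i) + real (a j)" using ij \<open>i \<noteq> j\<close> by (simp add: of_nat_diff)
    have "a i * a j \<le> ?a i * ?a j"
    proof -
      obtain x where "a i = Suc x" "a j \<le> x" using ij by (cases "a i") auto
      thus ?thesis using \<open>i \<noteq> j\<close> by simp
    qed
    hence p: "real (a i) * real (a j) \<le> real (?a i) * real (?a j)"
      by (metis of_nat_le_iff of_nat_mult)
    show "(\<Prod>k\<in>J. real (a k)) * (1 / fact (card J) + (real (a i) + real (a j)) / fact (card J + 1) +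
        real (a i) * real (a j) / fact (card J + 2))
      \<le> (\<Prod>k\<in>J. real (?a k)) * (1 / fact (card J) + (real (?a i) + real (?a j)) / fact (card J + 1) +
        real (?a i) * real (?a j) / fact (card J + 2))"
      unfolding J s by (intro mult_left_mono add_left_mono divide_right_mono p prod_nonneg) auto
  qed
qed

lemma sum_update2:
  fixes f :: "nat \<Rightarrow> 'b::comm_monoid_add"
  assumes "finite A" "i \<in> A" "j \<in> A" "i \<noteq> j"
  shows "(\<Sum>k\<in>A. f ((a(i := x, j := y)) k)) = f x + f y + (\<Sum>k\<in>A - {i, j}. f (a k))"
proof -
  have "A = insert i (insert j (A - {i, j}))" using assms by auto
  hence "(\<Sum>k\<in>A. f ((a(i := x, j := y)) k)) = (\<Sum>k\<in>insert i (insert j (A - {i, j})). f ((a(i := x, j := y)) k))"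
    by simp
  also have "\<dots> = f x + f y + (\<Sum>k\<in>A - {i, j}. f ((a(i := x, j := y)) k))"
    using assms by (simp add: add.assoc)
  also have "(\<Sum>k\<in>A - {i, j}. f ((a(i := x, j := y)) k)) = (\<Sum>k\<in>A - {i, j}. f (a k))"
    by (intro sum.cong) auto
  finally show ?thesis .
qed

text \<open>Moving a unit between two entries that differ by at least 2 keeps the sum and strictly
  decreases the sum of squares, so repeated moves terminate.\<close>

lemma exists_balanced:
  assumes "finite A"
  shows "\<exists>b. balanced A b \<and> sum b A = sum a A \<and> weight A a \<le> weight A b"
proof (induction "\<Sum>i\<in>A. a i ^ 2" arbitrary: a rule: less_induct)
  case less
  show ?case
  proof (cases "balanced A a")
    case False
    then obtain i j where ij: "i \<in> A" "j \<in> A" "a j + 2 \<le> a i" unfolding balanced_def by force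
    let ?a = "a(i := a i - 1, j := a j + 1)"
    have ne: "i \<noteq> j" using ij by auto
    have a: "a(i := a i, j := a j) = a" by simp
    have "a i - 1 + (a j + 1) = a i + a j" using ij(3) by simp
    hence 1: "sum ?a A = sum a A"
      using sum_update2[OF assms ij(1,2) ne, of "\<lambda>x. x" a "a i - 1" "a j + 1"]
        sum_update2[OF assms ij(1,2) ne, of "\<lambda>x. x" a "a i" "a j"] by simp
    obtain x where "a i = Suc x" "a j < x" using ij(3) by (cases "a i") auto
    hence "(a i - 1)\<^sup>2 + (a j + 1)\<^sup>2 < (a i)\<^sup>2 + (a j)\<^sup>2" by (simp add: power2_eq_square)
    hence "(\<Sum>i\<in>A. ?a i ^ 2) < (\<Sum>i\<in>A. a i ^ 2)"
      using sum_update2[OF assms ij(1,2) ne, of "\<lambda>x. x^2" a "a i - 1" "a j + 1"]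
        sum_update2[OF assms ij(1,2) ne, of "\<lambda>x. x^2" a "a i" "a j"] by simp
    from less[OF this] show ?thesis
      using 1 weight_move[of A i j a] assms ij by (metis order_trans)
  qed auto
qed

text \<open>All entries are the minimum l or l + 1, and since l is attained, fewer than
  \<open>card A\<close> of them are l + 1. Uniqueness of division with remainder then identifies l
  and the number of larger entries.\<close>

lemma balanced_values:
  assumes "finite A" "A \<noteq> {}" "balanced A a"
  defines "m \<equiv> sum a A div card A"
  shows "\<forall>i\<in>A. a i = m \<or> a i = m + 1" "card {i \<in> A. a i = m + 1} = sum a A mod card A"
proof -
  define l where "l = Min (a ` A)"
  have "l \<in> a ` A" unfolding l_def using assms(1,2) by (intro Min_in) auto
  then obtain j where j: "j \<in> A" "l = a j" by auto
  have val: "a i = l \<or> a i = l + 1" if "i \<in> A" for i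
  proof -
    have "l \<le> a i" unfolding l_def using that assms(1) by simp
    moreover have "a i \<le> l + 1" using assms(3) that j unfolding balanced_def by auto
    ultimately show ?thesis by auto
  qed
  let ?U = "{i \<in> A. a i = l + 1}"
  have "sum a A = (\<Sum>i\<in>A. l + (if a i = l + 1 then 1 else 0))"
    using val by (intro sum.cong) auto
  also have "\<dots> = l * card A + card ?U"
    using assms(1) by (simp add: sum.distrib sum.If_cases Int_def)
  finally have s: "sum a A = l * card A + card ?U" .
  have "j \<notin> ?U" using j by simp
  hence "?U \<subset> A" using j(1) by blast
  hence lt: "card ?U < card A" using assms(1) psubset_card_mono by blast
  hence "m = l" unfolding m_def s by simp
  thus "\<forall>i\<in>A. a i = m \<or> a i = m + 1" "card {i \<in> A. a i = m + 1} = sum a A mod card A"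
    using val s lt by auto
qed

lemma weight_reindex:
  assumes "bij_betw f A B"
  shows "weight B b = weight A (b \<circ> f)"
proof -
  have inj: "inj_on f A" and B: "B = f ` A" using assms by (auto simp: bij_betw_def)
  have "weight B b = (\<Sum>I\<in>Pow A. (\<Prod>i\<in>f ` I. real (b i)) / fact (card (f ` I)))"
    unfolding weight_def B using inj by (subst image_Pow_surj[OF refl, symmetric], subst sum.reindex)
      (auto intro: inj_on_image_Pow)
  also have "\<dots> = weight A (b \<circ> f)"
    unfolding weight_def
  proof (intro sum.cong refl)
    fix I assume "I \<in> Pow A"
    hence "inj_on f I" using inj inj_on_subset by blast
    thus "(\<Prod>i\<in>f ` I. real (b i)) / fact (card (f ` I)) = (\<Prod>i\<in>I. real ((b \<circ> f) i)) / fact (card I)"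
      by (simp add: prod.reindex card_image)
  qed
  finally show ?thesis .
qed

lemma weight_cong: "(\<And>i. i \<in> A \<Longrightarrow> a i = b i) \<Longrightarrow> weight A a = weight A b"
  unfolding weight_def by (intro sum.cong arg_cong2[of _ _ _ _ "(/)"] prod.cong) auto

text \<open>By \<open>balanced_values\<close> both functions take the same two values equally often,
  so one is a rearrangement of the other, and the weight is symmetric.\<close>

lemma weight_balanced_eq:
  assumes "finite A" "finite B" "card A = card B" "balanced A a" "balanced B b" "sum a A = sum b B"
  shows "weight A a = weight B b"
proof (cases "A = {}")
  case True
  hence "B = {}" using assms by auto
  thus ?thesis using True by (simp add: weight_def)
next
  case False
  hence "B \<noteq> {}" using assms by auto
  define m where "m = sum a A div card A"
  have m': "m = sum b B div card B" using assms by (simp add: m_def)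
  note a = balanced_values[OF assms(1) False assms(4), folded m_def]
  note b = balanced_values[OF assms(2) \<open>B \<noteq> {}\<close> assms(5), folded m']
  let ?A = "{i \<in> A. a i = m + 1}" and ?B = "{i \<in> B. b i = m + 1}"
  have c: "card ?A = card ?B" using a(2) b(2) assms by simp
  then obtain f where f: "bij_betw f ?A ?B"
    using finite_same_card_bij[of ?A ?B] assms by auto
  have "card (A - ?A) = card (B - ?B)" using c assms by (simp add: card_Diff_subset)
  then obtain g where g: "bij_betw g (A - ?A) (B - ?B)"
    using finite_same_card_bij[of "A - ?A" "B - ?B"] assms by auto
  define h where "h i = (if i \<in> ?A then f i else g i)" for i
  have "bij_betw h ?A ?B" using f by (subst bij_betw_cong[of _ _ f]) (auto simp: h_def)
  moreover have "bij_betw h (A - ?A) (B - ?B)" using g by (subst bij_betw_cong[of _ _ g]) (auto simp: h_def)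
  ultimately have "bij_betw h (?A \<union> (A - ?A)) (?B \<union> (B - ?B))" by (rule bij_betw_combine) auto
  moreover have "?A \<union> (A - ?A) = A" "?B \<union> (B - ?B) = B" by auto
  ultimately have h: "bij_betw h A B" by simp
  have "(b \<circ> h) i = a i" if "i \<in> A" for i
  proof (cases "i \<in> ?A")
    case True
    hence "h i \<in> ?B" using f by (auto simp: h_def bij_betw_def)
    thus ?thesis using True by simp
  next
    case False
    hence "h i \<in> B - ?B" using g that by (auto simp: h_def bij_betw_def)
    thus ?thesis using False that a(1) b(1) by auto
  qed
  thus ?thesis unfolding weight_reindex[OF h] by (intro weight_cong) auto
qed

text \<open>An instance of Hermite's identity. Passing from N to N + 1 drops the quotient of N and
  brings in that of N + d, which is larger by 1.\<close>

lemma sum_floor_shifts: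
  assumes "d > 0"
  shows "(\<Sum>k\<in>{1..d}. (N + k - 1) div d) = (N::nat)"
proof -
  have "(\<Sum>k<d. (N + k) div d) = N"
  proof (induction N)
    case (Suc N)
    have "(\<Sum>k<d. (Suc N + k) div d) + N div d = (\<Sum>k<Suc d. (N + k) div d)"
      by (subst sum.lessThan_Suc_shift) simp
    also have "\<dots> = N + (N div d + 1)" using Suc assms by simp
    finally show ?case by simp
  qed simp
  also have "(\<Sum>k<d. (N + k) div d) = (\<Sum>k\<in>{1..d}. (N + k - 1) div d)"
    by (rule sum.reindex_bij_witness[of _ "\<lambda>k. k - 1" Suc]) auto
  finally show ?thesis .
qed

lemma balanced_floor_shifts:
  assumes "d > 0"
  shows "balanced {1..d} (\<lambda>k. (N + k - 1) div d)"
  unfolding balanced_def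
proof (intro ballI)
  fix i j assume "i \<in> {1..d}" "j \<in> {1..d}"
  hence "N + i - 1 \<le> N + j - 1 + d" by auto
  hence "(N + i - 1) div d \<le> (N + j - 1 + d) div d" by (rule div_le_mono)
  thus "(N + i - 1) div d \<le> (N + j - 1) div d + 1" using assms by simp
qed

text \<open>With N = n - 1 the shift N + i - 1 is n - 2 + i. As n and i are at least 1, the
  subtractions on naturals do not truncate, not even for n = 1.\<close>

lemma weight_floor_shifts:
  assumes "n \<ge> 1"
  shows "(\<Sum>I\<in>Pow {1..d}. 1 / fact (card I) * (\<Prod>i\<in>I. real_of_int \<lfloor>(real n - 2 + real i) / real d\<rfloor>)) =
    weight {1..d} (\<lambda>k. (n - 1 + k - 1) div d)"
  unfolding weight_def
proof (intro sum.cong refl)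
  fix I assume I: "I \<in> Pow {1..d}"
  have "(\<Prod>i\<in>I. real_of_int \<lfloor>(real n - 2 + real i) / real d\<rfloor>) = (\<Prod>i\<in>I. real ((n - 1 + i - 1) div d))"
  proof (intro prod.cong refl)
    fix i assume "i \<in> I"
    hence "i \<ge> 1" using I by auto
    hence "real n - 2 + real i = real (n - 1 + i - 1)" using assms by simp
    thus "real_of_int \<lfloor>(real n - 2 + real i) / real d\<rfloor> = real ((n - 1 + i - 1) div d)"
      by (simp only: floor_divide_of_nat_eq of_int_of_nat_eq)
  qed
  thus "1 / fact (card I) * (\<Prod>i\<in>I. real_of_int \<lfloor>(real n - 2 + real i) / real d\<rfloor>) =
    (\<Prod>i\<in>I. real ((n - 1 + i - 1) div d)) / fact (card I)" by simp
qed

subsection \<open>Unit cubes\<close>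

text \<open>Cubes are named by their lower corners, taken as real vectors so that hulls of corners
  can be formed directly.\<close>

definition unit_cube :: "real^'d \<Rightarrow> (real^'d) set" where
  "unit_cube x = cbox x (x + 1)"

lemma mem_unit_cube: "w \<in> unit_cube x \<longleftrightarrow> (\<forall>i. x$i \<le> w$i \<and> w$i \<le> x$i + 1)"
  by (simp add: unit_cube_def mem_box_cart)

lemma inj_unit_cube: "inj (unit_cube :: real^'d \<Rightarrow> _)"
proof (rule injI)
  fix x y :: "real^'d" assume eq: "unit_cube x = unit_cube y"
  have "x \<in> unit_cube x" "y \<in> unit_cube y" by (auto simp: mem_unit_cube)
  hence "x \<in> unit_cube y" "y \<in> unit_cube x" using eq by auto
  hence "x$i = y$i" for i unfolding mem_unit_cube by (metis order_antisym)
  thus "x = y" by (simp add: vec_eq_iff)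
qed

lemma grid_cube_iff: "grid_cube C \<longleftrightarrow> (\<exists>x. (\<forall>i. x$i \<in> \<int>) \<and> C = unit_cube x)"
proof
  assume "grid_cube C"
  then obtain z :: "int^'a" where "C = cbox (\<chi> i. of_int (z$i)) (\<chi> i. of_int (z$i) + 1)"
    unfolding grid_cube_def by blast
  moreover have "(\<chi> i. of_int (z$i) + 1) = (\<chi> i. of_int (z$i)) + (1::real^'a)" by (simp add: vec_eq_iff)
  ultimately show "\<exists>x. (\<forall>i. x$i \<in> \<int>) \<and> C = unit_cube x"
    unfolding unit_cube_def by (intro exI[of _ "\<chi> i. of_int (z$i)"]) auto
next
  assume "\<exists>x. (\<forall>i. x$i \<in> \<int>) \<and> C = unit_cube x"
  then obtain x where x: "\<forall>i. x$i \<in> \<int>" "C = unit_cube x" by blast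
  have "(\<chi> i. of_int ((\<chi> i. \<lfloor>x$i\<rfloor>) $ i)) = x" "(\<chi> i. of_int ((\<chi> i. \<lfloor>x$i\<rfloor>) $ i) + 1) = x + 1"
    using x(1) by (auto simp: vec_eq_iff)
  thus "grid_cube C" unfolding grid_cube_def x(2) unit_cube_def by metis
qed

lemma unit_cube_eq_translate: "unit_cube x = {x} + cbox 0 (1::real^'d)"
proof (intro set_eqI iffI)
  fix w assume "w \<in> unit_cube x"
  hence "w - x \<in> cbox 0 1" by (auto simp: mem_unit_cube mem_box_cart algebra_simps)
  thus "w \<in> {x} + cbox 0 1" by (metis add.commute diff_add_cancel insertI1 set_plus_intro)
next
  fix w assume "w \<in> {x} + cbox 0 (1::real^'d)"
  thus "w \<in> unit_cube x" by (auto simp: mem_unit_cube mem_box_cart set_plus_def)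
qed

lemma aff_dim_unit_cube: "aff_dim (unit_cube (x::real^'d)) = int CARD('d)"
proof -
  have "(\<chi> i. x$i + 1/2) \<in> box x (x + 1)" by (simp add: mem_box_cart)
  hence "interior (unit_cube x) \<noteq> {}" unfolding unit_cube_def interior_cbox by blast
  thus ?thesis by (simp add: aff_dim_nonempty_interior)
qed

text \<open>In each coordinate where the corners differ they differ by 1, and the common facet lies
  in the hyperplane separating the cubes. Two such coordinates would confine it to a set of
  codimension 2, too small for a facet.\<close>

lemma share_facet_unit_cubeD:
  fixes x y :: "real^'d"
  assumes "share_facet (unit_cube x) (unit_cube y)" and Z: "\<forall>i. x$i \<in> \<int>" "\<forall>i. y$i \<in> \<int>"
  shows "x = y \<or> (\<exists>i c. \<bar>c\<bar> = 1 \<and> y = x + c *\<^sub>R axis i 1)"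
proof (cases "x = y")
  case False
  then obtain i where i: "x$i \<noteq> y$i" by (auto simp: vec_eq_iff)
  obtain F where F: "F facet_of unit_cube x" "F facet_of unit_cube y"
    using assms(1) unfolding share_facet_def by blast
  have FC: "F \<subseteq> unit_cube x" "F \<subseteq> unit_cube y" "F \<noteq> {}" "aff_dim F = int CARD('d) - 1"
    using facet_of_imp_subset[OF F(1)] facet_of_imp_subset[OF F(2)] F
    by (simp_all add: facet_of_def aff_dim_unit_cube)
  have hyp: "\<bar>y$j - x$j\<bar> = 1 \<and> (\<forall>w\<in>F. w$j = max (x$j) (y$j))" if j: "x$j \<noteq> y$j" for j
  proof -
    obtain a b where ab: "x$j = real_of_int a" "y$j = real_of_int b" using Z by (metis Ints_cases)
    have w: "a \<le> w$j \<and> w$j \<le> real_of_int a + 1 \<and> b \<le> w$j \<and> w$j \<le> real_of_int b + 1" if "w \<in> F" for w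
      using that FC(1,2) ab unfolding mem_unit_cube[abs_def] subset_iff by (metis mem_unit_cube)
    obtain w0 where "w0 \<in> F" using FC(3) by blast
    hence "real_of_int a \<le> real_of_int b + 1" "real_of_int b \<le> real_of_int a + 1" using w[of w0] by linarith+
    hence "a \<le> b + 1" "b \<le> a + 1" by linarith+
    moreover have "a \<noteq> b" using j ab by auto
    ultimately have "b = a + 1 \<or> a = b + 1" by linarith
    thus ?thesis using w ab by fastforce
  qed
  have same: "j = i" if j: "x$j \<noteq> y$j" for j
  proof (rule ccontr)
    assume ne: "j \<noteq> i"
    let ?A = "{w::real^'d. axis i 1 \<bullet> w = max (x$i) (y$i)}" and ?B = "{w::real^'d. axis j 1 \<bullet> w = max (x$j) (y$j)}"
    have FAB: "F \<subseteq> ?A \<inter> ?B" using hyp[OF i] hyp[OF j] by (auto simp: inner_axis')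
    have aff: "affine ?A" "affine (?A \<inter> ?B)" by (auto intro: affine_hyperplane affine_Int)
    have "aff_dim ?A = int CARD('d) - 1" by (simp add: aff_dim_hyperplane)
    moreover have "aff_dim (?A \<inter> ?B) \<le> aff_dim ?A" by (intro aff_dim_subset) auto
    moreover have "int CARD('d) - 1 \<le> aff_dim (?A \<inter> ?B)" using aff_dim_subset[OF FAB] FC(4) by simp
    ultimately have "aff_dim (?A \<inter> ?B) = aff_dim ?A" by linarith
    \<comment> \<open>Affine sets of equal dimension, one inside the other, coincide; moving a point
      of \<open>F\<close> along axis \<open>j\<close> will refute this.\<close>
    hence eq: "?A \<inter> ?B = ?A" using aff FAB FC(3) by (intro affine_dim_equal) auto
    obtain w where "w \<in> F" using FC(3) by blast
    hence w: "w$i = max (x$i) (y$i)" "w$j = max (x$j) (y$j)" using hyp[OF i] hyp[OF j] by auto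
    moreover have "(axis j 1 :: real^'d)$i = 0" using ne by (simp add: axis_def)
    ultimately have "w + axis j 1 \<in> ?A" by (simp add: inner_axis')
    hence "w + axis j 1 \<in> ?B" using eq by blast
    thus False using w by (simp add: inner_axis')
  qed
  have "y$j = x$j" if "j \<noteq> i" for j using same[of j] that by metis
  hence "y = x + (y$i - x$i) *\<^sub>R axis i 1" by (auto simp: vec_eq_iff axis_def)
  thus ?thesis using hyp[OF i] by blast
qed simp

lemma share_facet_unit_cubeI:
  "share_facet (unit_cube (x::real^'d)) (unit_cube (x + axis i 1))"
proof -
  let ?H = "{w::real^'d. axis i 1 \<bullet> w = x$i + 1}"
  have F: "(unit_cube y \<inter> ?H) facet_of unit_cube y"
    if "y$i = x$i \<or> y$i = x$i + 1" for y :: "real^'d"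
  proof -
    have conv: "convex (unit_cube y)" unfolding unit_cube_def by (rule convex_box)
    have face: "(unit_cube y \<inter> ?H) face_of unit_cube y"
      using that
    proof
      assume y: "y$i = x$i"
      have "w$i \<le> x$i + 1" if "w \<in> unit_cube y" for w using that y unfolding mem_unit_cube by metis
      thus ?thesis using conv by (intro face_of_Int_supporting_hyperplane_le) (auto simp: inner_axis')
    next
      assume "y$i = x$i + 1"
      hence "x$i + 1 \<le> w$i" if "w \<in> unit_cube y" for w using that unfolding mem_unit_cube by metis
      thus ?thesis using conv by (intro face_of_Int_supporting_hyperplane_ge) (auto simp: inner_axis')
    qed
    let ?F = "unit_cube y \<inter> ?H"
    define p where "p = (\<chi> j. if j = i then x$i + 1 else y$j)"
    \<comment> \<open>A point of the cube at distance 1 from the hyperplane, on whichever side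
      \<open>y\<close> lies. Together with the face it spans the cube affinely, so the face has
      codimension at most 1.\<close>
    define q where "q = (\<chi> j. if j = i then (if y$i = x$i then x$i else x$i + 2) else y$j)"
    define e where "e = (if y$i = x$i then - 1 else 1 :: real)"
    have qp: "q - p = e *\<^sub>R axis i 1" using that
      by (auto simp: vec_eq_iff p_def q_def e_def axis_def)
    have p: "p \<in> ?F" using that by (auto simp: p_def mem_unit_cube inner_axis')
    have q: "q \<in> unit_cube y" "q \<notin> ?F" using that by (auto simp: q_def mem_unit_cube inner_axis')
    have "unit_cube y \<subseteq> affine hull (insert q ?F)"
    proof
      fix w assume w: "w \<in> unit_cube y"
      define v where "v = (\<chi> j. if j = i then x$i + 1 else w$j)"
      have "v \<in> ?F" using w that unfolding v_def by (auto simp: mem_unit_cube inner_axis')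
      hence "v \<in> affine hull (insert q ?F)" "p \<in> affine hull (insert q ?F)" "q \<in> affine hull (insert q ?F)"
        using p by (auto intro: hull_inc)
      hence "v + ((w$i - x$i - 1) * e) *\<^sub>R (q - p) \<in> affine hull (insert q ?F)"
        by (intro mem_affine_3_minus affine_affine_hull)
      moreover have "v + ((w$i - x$i - 1) * e) *\<^sub>R (q - p) = w"
        unfolding qp by (auto simp: vec_eq_iff v_def e_def axis_def)
      ultimately show "w \<in> affine hull (insert q ?F)" by simp
    qed
    hence "aff_dim (unit_cube y) \<le> aff_dim (insert q ?F)"
      using aff_dim_subset aff_dim_affine_hull by metis
    also have "\<dots> \<le> aff_dim ?F + 1" by (simp add: aff_dim_insert)
    finally have "aff_dim (unit_cube y) \<le> aff_dim ?F + 1" .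
    moreover have "aff_dim ?F < aff_dim (unit_cube y)"
      using face conv q by (intro face_of_aff_dim_lt) auto
    ultimately show ?thesis using face p unfolding facet_of_def by auto
  qed
  have "unit_cube x \<inter> ?H = unit_cube (x + axis i 1) \<inter> ?H"
  proof (intro set_eqI)
    fix w :: "real^'d"
    have "x$j \<le> w$j \<and> w$j \<le> x$j + 1 \<longleftrightarrow> (x + axis i 1)$j \<le> w$j \<and> w$j \<le> (x + axis i 1)$j + 1"
      if "w$i = x$i + 1" for j
      using that by (cases "j = i") (auto simp: axis_def)
    thus "w \<in> unit_cube x \<inter> ?H \<longleftrightarrow> w \<in> unit_cube (x + axis i 1) \<inter> ?H"
      unfolding Int_iff mem_unit_cube mem_Collect_eq inner_axis' by auto
  qed
  moreover have "(x + axis i 1)$i = x$i + 1" by (simp add: axis_def)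
  ultimately show ?thesis using F[of x] F[of "x + axis i 1"] unfolding share_facet_def by metis
qed

text \<open>The union is a Minkowski sum of the corners with the cube; convex hulls distribute over
  such sums, and the cube is its own hull.\<close>

lemma hull_Union_unit_cubes:
  fixes Z :: "(real^'d) set"
  shows "convex hull (\<Union>z\<in>Z. unit_cube z) = thicken UNIV (convex hull Z)"
proof -
  have "(\<Union>z\<in>Z. unit_cube z) = Z + cbox 0 1"
    unfolding unit_cube_eq_translate by (auto simp: set_plus_def)
  hence "convex hull (\<Union>z\<in>Z. unit_cube z) = convex hull Z + cbox 0 1"
    by (simp add: convex_hull_set_plus hull_same convex_box)
  also have "\<dots> = (\<Union>z\<in>convex hull Z. unit_cube z)"
    unfolding unit_cube_eq_translate by (auto simp: set_plus_def)
  also have "\<dots> = thicken UNIV (convex hull Z)"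
    unfolding thicken_def by (auto simp: mem_unit_cube Bex_def)
  finally show ?thesis .
qed

lemma measure_hull_unit_cubes:
  fixes Z :: "(real^'d) set"
  assumes "finite Z"
  shows "measure lebesgue (convex hull (\<Union>z\<in>Z. unit_cube z)) =
    (\<Sum>I\<in>UNIV. measure lborel (shadow (- I) (convex hull Z)))"
proof -
  let ?K = "convex hull Z"
  have K: "compact ?K" "convex ?K" using assms by (auto simp: finite_imp_compact_convex_hull)
  have "ennreal (measure lborel (thicken UNIV ?K)) = (\<Sum>S\<in>UNIV. ennreal (measure lborel (shadow S ?K)))"
    using emeasure_thicken[OF K, of UNIV] K
    by (simp add: emeasure_compact_eq_measure compact_thicken compact_shadow)
  also have "\<dots> = ennreal (\<Sum>S\<in>UNIV. measure lborel (shadow S ?K))" by (intro sum_ennreal) auto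
  finally have "measure lborel (thicken UNIV ?K) = (\<Sum>S\<in>UNIV. measure lborel (shadow S ?K))"
    by (subst (asm) ennreal_inj) (auto intro: sum_nonneg)
  also have "\<dots> = (\<Sum>I\<in>UNIV. measure lborel (shadow (- I) ?K))"
    by (rule sum.reindex_bij_witness[of _ uminus uminus]) auto
  finally show ?thesis
    using K by (simp add: hull_Union_unit_cubes measure_lebesgue_compact compact_thicken)
qed

subsection \<open>Bounds for polyominoes\<close>

definition axis_steps :: "(real^'d) set \<Rightarrow> ((real^'d) \<times> (real^'d)) set" where
  "axis_steps Z = {(x, y). x \<in> Z \<and> y \<in> Z \<and> (x = y \<or> (\<exists>i c. \<bar>c\<bar> = 1 \<and> y = x + c *\<^sub>R axis i 1))}"

text \<open>The start of the growth: a point has volume 1 in dimension 0 and 0 in every other,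
  matching the empty product and the products of zeros.\<close>

lemma measure_shadow_singleton:
  "measure lborel (shadow S {z :: real^'d}) = (if S = UNIV then 1 else 0)"
proof (cases "S = UNIV")
  case True
  have "shadow UNIV {z} = unit_cube 0" unfolding shadow_def by (auto simp: mem_unit_cube)
  moreover have "unit_cube (0::real^'d) \<noteq> {}" using mem_unit_cube[of 0 0] by auto
  ultimately show ?thesis using True
    by (simp add: unit_cube_def content_cbox_cart)
next
  case False
  then obtain i where i: "i \<notin> S" by blast
  have "shadow S {z} \<subseteq> {x. axis i 1 \<bullet> x = z$i}" using i unfolding shadow_def by (auto simp: inner_axis')
  hence "negligible (shadow S {z})"
    by (rule negligible_subset[OF negligible_hyperplane, rotated]) simp
  hence "measure lebesgue (shadow S {z}) = 0" by (simp add: negligible_imp_measure0)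
  thus ?thesis using False measure_lebesgue_compact[of "shadow S {z}"] by (simp add: compact_shadow)
qed

text \<open>The new point and \<open>p\<close> agree after coordinate \<open>i\<close> is projected
  away, so replacing one by the other in a convex combination does not affect the shadow.\<close>

lemma shadow_hull_insert_subset:
  fixes K :: "(real^'d) set"
  assumes "convex K" "p \<in> K" "i \<in> S"
  shows "shadow S (convex hull (insert (p + c *\<^sub>R axis i 1) K)) \<subseteq> shadow S K"
proof
  fix x assume "x \<in> shadow S (convex hull (insert (p + c *\<^sub>R axis i 1) K))"
  then obtain w where w: "w \<in> convex hull (insert (p + c *\<^sub>R axis i 1) K)"
    "\<forall>j\<in>S. 0 \<le> x$j \<and> x$j \<le> 1" "\<forall>j. j \<notin> S \<longrightarrow> x$j = w$j" unfolding shadow_def by blast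
  have "K \<noteq> {}" using assms by auto
  then obtain l m k where k: "0 \<le> l" "0 \<le> m" "l + m = 1" "k \<in> K" "w = l *\<^sub>R (p + c *\<^sub>R axis i 1) + m *\<^sub>R k"
    using w(1) assms(1) by (auto simp: convex_hull_insert hull_same)
  have "l *\<^sub>R p + m *\<^sub>R k \<in> K" using assms k by (intro convexD) auto
  moreover have "\<forall>j. j \<notin> S \<longrightarrow> x$j = (l *\<^sub>R p + m *\<^sub>R k)$j"
    using w(3) assms(3) unfolding k(5) by (auto simp: axis_def)
  ultimately show "x \<in> shadow S K" using w(2) unfolding shadow_def by blast
qed

text \<open>If \<open>i \<in> S\<close>, neither side feels the step. Otherwise the pyramid, bounded
  through \<open>insert i S\<close>, supplies just the term that raises the factor
  \<open>a i\<close> by 1.\<close>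

lemma measure_shadow_hull_step:
  fixes Y :: "(real^'d) set" and a :: "'d \<Rightarrow> nat"
  assumes Y: "finite Y" "p \<in> Y" and c: "\<bar>c\<bar> = 1"
    and bound: "\<And>S. measure lborel (shadow S (convex hull Y)) \<le> (\<Prod>j\<in>- S. real (a j)) / fact (card (- S))"
  shows "measure lborel (shadow S (convex hull (insert (p + c *\<^sub>R axis i 1) Y)))
    \<le> (\<Prod>j\<in>- S. real ((a(i := a i + 1)) j)) / fact (card (- S))"
proof -
  let ?K = "convex hull Y" and ?a = "a(i := a i + 1)"
  have K: "compact ?K" "convex ?K" "p \<in> ?K" using Y by (auto simp: finite_imp_compact_convex_hull hull_inc)
  have H: "convex hull (insert (p + c *\<^sub>R axis i 1) Y) = convex hull (insert (p + c *\<^sub>R axis i 1) ?K)"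
    by (rule hull_insert)
  show ?thesis
  proof (cases "i \<in> S")
    case True
    have cS: "compact (shadow S ?K)" by (intro compact_shadow K)
    have "compact (shadow S (convex hull (insert (p + c *\<^sub>R axis i 1) ?K)))"
      using K by (intro compact_shadow compact_convex_hull) auto
    hence "measure lborel (shadow S (convex hull (insert (p + c *\<^sub>R axis i 1) ?K))) \<le> measure lborel (shadow S ?K)"
      using measure_mono_fmeasurable[OF shadow_hull_insert_subset[OF K(2,3) True, of c], of lebesgue] cS
      by (simp add: lmeasurable_compact measure_lebesgue_compact fmeasurableD)
    also note bound[of S]
    also have "(\<Prod>j\<in>- S. real (a j)) = (\<Prod>j\<in>- S. real (?a j))" using True by (intro prod.cong) auto
    finally show ?thesis unfolding H .
  next
    case False
    let ?C = "- insert i S"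
    have C: "- S = insert i ?C" "i \<notin> ?C" "finite ?C" using False by auto
    have card: "card (- S) = Suc (card ?C)" unfolding C(1) using C(2,3) by (rule card_insert_disjoint[rotated])
    have "measure lborel (shadow S (convex hull (insert (p + c *\<^sub>R axis i 1) ?K)))
      \<le> measure lborel (shadow S ?K) + \<bar>c\<bar> * measure lborel (shadow (insert i S) ?K) / card (- S)"
      using c by (intro measure_shadow_hull_insert K False) auto
    also have "\<dots> \<le> (\<Prod>j\<in>- S. real (a j)) / fact (card (- S)) + (\<Prod>j\<in>?C. real (a j)) / fact (card ?C) / card (- S)"
      unfolding c mult_1 by (intro add_mono bound divide_right_mono) auto
    also have "\<dots> = (\<Prod>j\<in>- S. real (a j)) / fact (card (- S)) + (\<Prod>j\<in>?C. real (a j)) / fact (card (- S))"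
      unfolding card by (simp add: mult.commute)
    also have "\<dots> = (real (a i) + 1) * (\<Prod>j\<in>?C. real (a j)) / fact (card (- S))"
      unfolding add_divide_distrib[symmetric] C(1) prod.insert[OF C(3,2)] by (simp add: algebra_simps)
    also have "(real (a i) + 1) * (\<Prod>j\<in>?C. real (a j)) = real (?a i) * (\<Prod>j\<in>?C. real (?a j))"
      by (intro arg_cong2[of _ _ _ _ "(*)"] prod.cong) auto
    also have "\<dots> = (\<Prod>j\<in>- S. real (?a j))" unfolding C(1) prod.insert[OF C(3,2)] ..
    finally show ?thesis unfolding H .
  qed
qed

text \<open>While \<open>Y\<close> is not all of \<open>Z\<close>, some step leaves it, since
  otherwise \<open>Y\<close> would contain everything reachable from \<open>z0\<close>. The witness
  \<open>a\<close> counts the steps taken in each direction.\<close>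

lemma connected_growth:
  fixes Z :: "(real^'d) set"
  assumes Z: "finite Z" "z0 \<in> Z" and conn: "\<And>z. z \<in> Z \<Longrightarrow> (z0, z) \<in> (axis_steps Z)\<^sup>*"
  shows "k < card Z \<Longrightarrow> \<exists>Y a. Y \<subseteq> Z \<and> z0 \<in> Y \<and> card Y = Suc k \<and> sum a UNIV = k \<and>
    (\<forall>S. measure lborel (shadow S (convex hull Y)) \<le> (\<Prod>j\<in>- S. real (a j)) / fact (card (- S)))"
proof (induction k)
  case 0
  have "measure lborel (shadow S (convex hull {z0})) \<le> (\<Prod>j\<in>- S. real 0) / fact (card (- S))" for S
    by (cases "S = UNIV") (auto simp: measure_shadow_singleton)
  thus ?case using Z by (intro exI[of _ "{z0}"] exI[of _ "\<lambda>_. 0"]) auto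
next
  case (Suc k)
  then obtain Y and a :: "'d \<Rightarrow> nat" where Y: "Y \<subseteq> Z" "z0 \<in> Y" "card Y = Suc k" "sum a UNIV = k"
    and bound: "\<And>S. measure lborel (shadow S (convex hull Y)) \<le> (\<Prod>j\<in>- S. real (a j)) / fact (card (- S))"
    by (metis Suc_lessD)
  have "Y \<noteq> Z" using Y Suc.prems by auto
  then obtain z where z: "z \<in> Z" "z \<notin> Y" using Y by blast
  have "\<exists>p q. (p, q) \<in> axis_steps Z \<and> p \<in> Y \<and> q \<notin> Y"
  proof (rule ccontr)
    assume "\<not> ?thesis"
    hence closed: "\<And>p q. (p, q) \<in> axis_steps Z \<Longrightarrow> p \<in> Y \<Longrightarrow> q \<in> Y" by blast
    have "z \<in> Y" using conn[OF z(1)] by (induction rule: rtrancl_induct) (use Y closed in auto)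
    thus False using z by simp
  qed
  \<comment> \<open>The trivial step \<open>x = y\<close> is ruled out because it cannot leave
    \<open>Y\<close>.\<close>
  then obtain p i c where pq: "p \<in> Y" "p + c *\<^sub>R axis i 1 \<in> Z" "p + c *\<^sub>R axis i 1 \<notin> Y" "\<bar>c\<bar> = 1"
    unfolding axis_steps_def by auto
  have fin: "finite Y" using Y(1) Z(1) finite_subset by blast
  let ?Y = "insert (p + c *\<^sub>R axis i 1) Y" and ?a = "a(i := a i + 1)"
  have "sum ?a UNIV = ?a i + sum ?a (UNIV - {i})" by (rule sum.remove) auto
  also have "sum ?a (UNIV - {i}) = sum a (UNIV - {i})" by (intro sum.cong) auto
  also have "?a i + sum a (UNIV - {i}) = Suc (sum a UNIV)" by (simp add: sum.remove[of UNIV i])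
  finally have "sum ?a UNIV = Suc k" using Y by simp
  moreover have "card ?Y = Suc (Suc k)" using Y fin pq by simp
  moreover have "?Y \<subseteq> Z" "z0 \<in> ?Y" using Y pq by auto
  ultimately show ?case
    using measure_shadow_hull_step[OF fin pq(1,4) bound]
    by (intro exI[of _ ?Y] exI[of _ ?a]) blast
qed

lemma polyomino_corners:
  fixes P :: "(real^'d) set set"
  assumes "polyomino n P" "n \<ge> 1"
  obtains Z z0 where "finite Z" "card Z = n" "P = unit_cube ` Z" "z0 \<in> Z"
    "\<And>z. z \<in> Z \<Longrightarrow> (z0, z) \<in> (axis_steps Z)\<^sup>*"
proof -
  define Z where "Z = {z. unit_cube z \<in> P}"
  have grid: "\<exists>x. (\<forall>i. x$i \<in> \<int>) \<and> C = unit_cube x" if "C \<in> P" for C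
    using assms(1) that unfolding polyomino_def grid_cube_iff by blast
  have P: "P = unit_cube ` Z" unfolding Z_def using grid by blast
  have int: "\<forall>i. z$i \<in> \<int>" if "z \<in> Z" for z
    using grid[of "unit_cube z"] that inj_unit_cube unfolding Z_def by (auto dest: injD)
  have inj: "inj_on unit_cube Z" using inj_unit_cube inj_on_subset by blast
  have "finite P" "card P = n" using assms(1) unfolding polyomino_def by auto
  hence Z: "finite Z" "card Z = n" using finite_imageD[OF _ inj] card_image[OF inj] unfolding P by auto
  then obtain z0 where z0: "z0 \<in> Z" using assms(2) by fastforce
  let ?R = "{(A, B). A \<in> P \<and> B \<in> P \<and> share_facet A B}"
  have "(z0, z) \<in> (axis_steps Z)\<^sup>*" if z: "z \<in> Z" for z
  proof -
    have "(unit_cube z0, unit_cube z) \<in> ?R\<^sup>*"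
      using assms(1) z z0 unfolding polyomino_def Z_def by blast
    \<comment> \<open>The chain runs through cubes, so the induction has to speak of every corner
      \<open>w\<close> naming the current cube; injectivity of \<open>unit_cube\<close> settles the
      base case.\<close>
    hence "\<forall>w. unit_cube z = unit_cube w \<longrightarrow> (z0, w) \<in> (axis_steps Z)\<^sup>*"
    proof (induction rule: rtrancl_induct)
      case base
      thus ?case using inj_unit_cube by (auto dest: injD)
    next
      case (step A B)
      show ?case
      proof (intro allI impI)
        fix w assume w: "B = unit_cube w"
        obtain v where v: "v \<in> Z" "A = unit_cube v" using step.hyps(2) P by blast
        have wZ: "w \<in> Z" using step.hyps(2) w by (auto simp: Z_def)
        have "share_facet (unit_cube v) (unit_cube w)" using step.hyps(2) v w by auto
        hence "(v, w) \<in> axis_steps Z"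
          using share_facet_unit_cubeD[of v w] int v(1) wZ unfolding axis_steps_def by blast
        moreover have "(z0, v) \<in> (axis_steps Z)\<^sup>*" using step.IH v(2) by blast
        ultimately show "(z0, w) \<in> (axis_steps Z)\<^sup>*" by (rule rtrancl_into_rtrancl[rotated])
      qed
    qed
    thus ?thesis by blast
  qed
  thus ?thesis using that Z P z0 by blast
qed

lemma measure_hull_polyomino_le:
  fixes P :: "(real^'d) set set"
  assumes "polyomino n P" "n \<ge> 1"
  obtains a :: "'d \<Rightarrow> nat" where "sum a UNIV = n - 1" "measure lebesgue (convex hull (\<Union>P)) \<le> weight UNIV a"
proof -
  obtain Z z0 where Z: "finite Z" "card Z = n" "P = unit_cube ` Z" "z0 \<in> Z"
    "\<And>z. z \<in> Z \<Longrightarrow> (z0, z) \<in> (axis_steps Z)\<^sup>*"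
    using polyomino_corners[OF assms] by blast
  have "n - 1 < card Z" using Z assms by simp
  then obtain Y and a :: "'d \<Rightarrow> nat" where Y: "Y \<subseteq> Z" "card Y = Suc (n - 1)" "sum a UNIV = n - 1"
    and bound: "\<And>S. measure lborel (shadow S (convex hull Y)) \<le> (\<Prod>j\<in>- S. real (a j)) / fact (card (- S))"
    using connected_growth[OF Z(1,4,5), of "n - 1"] by blast
  \<comment> \<open>After n - 1 steps the growth has exhausted the polyomino.\<close>
  have "Y = Z" using Y Z assms by (intro card_subset_eq) auto
  have "measure lebesgue (convex hull (\<Union>P)) = (\<Sum>I\<in>UNIV. measure lborel (shadow (- I) (convex hull Y)))"
    unfolding Z(3) \<open>Y = Z\<close> using Z(1) by (rule measure_hull_unit_cubes)
  also have "\<dots> \<le> weight UNIV a"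
    unfolding weight_def Pow_UNIV by (intro sum_mono) (use bound[of "- _"] in simp)
  finally show ?thesis using that Y(3) by blast
qed

section \<open>Lower bound: simplices inside star-shaped polyominoes\<close>

lemma measure_shadow_simplex_ge:
  fixes a :: "'d::finite \<Rightarrow> nat"
  assumes "finite I"
  shows "(\<Prod>i\<in>I. real (a i)) / fact (card I) \<le>
    measure lborel (shadow (- I) (convex hull (insert 0 ((\<lambda>i. real (a i) *\<^sub>R axis i 1 :: real^'d) ` I))))"
  using assms
proof (induction I)
  case empty
  show ?case by (simp add: measure_shadow_singleton)
next
  case (insert i I)
  let ?v = "\<lambda>i. real (a i) *\<^sub>R axis i 1 :: real^'d"
  let ?S = "- insert i I"
  define K where "K = convex hull (insert 0 (?v ` I))"
  define H where "H = convex hull (insert 0 (?v ` insert i I))"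
  have K: "compact K" unfolding K_def by (simp add: finite_imp_compact_convex_hull)
  have "convex {u::real^'d. u$i = 0}"
    by (auto intro!: convexI)
  moreover have "insert 0 (?v ` I) \<subseteq> {u::real^'d. u$i = 0}" using insert.hyps by (auto simp: axis_def)
  \<comment> \<open>The smaller simplex lies at height 0, so a combination giving weight
    \<open>x$i\<close> to the new vertex has height \<open>x$i * real (a i)\<close>.\<close>
  ultimately have Ki: "u$i = 0" if "u \<in> K" for u
    using that hull_minimal[of "insert 0 (?v ` I)" "{u. u$i = 0}" convex] unfolding K_def by blast
  have KH: "K \<subseteq> H" unfolding K_def H_def by (intro hull_mono) auto
  have H: "compact H" "convex H" "?v i \<in> H" unfolding H_def by (auto simp: finite_imp_compact_convex_hull hull_inc)
  \<comment> \<open>The simplex on \<open>insert i I\<close> is a pyramid over the one on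
    \<open>I\<close>. Its new vertex projects to 0 along \<open>i\<close>, hence the apex parameter
    0; the height 1 is stretched to \<open>a i\<close> by \<open>?f\<close>. If
    \<open>a i = 0\<close>, the stretch collapses the pyramid and the claimed bound is 0.\<close>
  let ?C = "apex_cone ?S i 0 K"
  let ?m = "\<lambda>j. if j = i then real (a i) else 1"
  let ?f = "\<lambda>x::real^'d. \<chi> j. ?m j * x$j"
  have iS: "insert i ?S = - I" using insert.hyps by auto
  have cC: "compact ?C" using K by (rule compact_apex_cone)
  have cf: "compact (?f ` ?C)" 
    by (intro compact_continuous_image cC continuous_on_vec_lambda continuous_intros)
  have sub: "?f ` ?C \<subseteq> shadow ?S H"
  proof
    fix y assume "y \<in> ?f ` ?C"
    then obtain x where x: "x \<in> ?C" and y: "y = ?f x" by blast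
    from x obtain u where u: "u \<in> K" "\<And>j. j \<in> insert i ?S \<Longrightarrow> 0 \<le> x$j \<and> x$j \<le> 1"
      "\<And>j. j \<notin> insert i ?S \<Longrightarrow> x$j = (1 - x$i) * u$j" unfolding apex_cone_def by auto
    let ?w = "(1 - x$i) *\<^sub>R u + (x$i) *\<^sub>R ?v i"
    have "?w \<in> H" using u(1,2) KH H by (intro convexD) auto
    moreover have "y$j = ?w$j" if "j \<notin> ?S" for j
      using u(3)[of j] Ki[OF u(1)] that unfolding y by (cases "j = i") (auto simp: axis_def)
    moreover have "0 \<le> y$j \<and> y$j \<le> 1" if "j \<in> ?S" for j
      using u(2)[of j] that unfolding y by auto
    ultimately show "y \<in> shadow ?S H" unfolding shadow_def by blast
  qed
  have "(\<Prod>j\<in>insert i I. real (a j)) / fact (card (insert i I)) =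
      real (a i) * ((\<Prod>j\<in>I. real (a j)) / fact (card I) / (real (card I) + 1))"
    using insert.hyps by (simp add: field_simps)
  also have "\<dots> \<le> real (a i) * (measure lborel (shadow (- I) K) / (real (card I) + 1))"
    using insert.IH unfolding K_def by (intro mult_left_mono divide_right_mono) auto
  also have "measure lborel (shadow (- I) K) / (real (card I) + 1) = measure lborel ?C"
  proof -
    have "ennreal (measure lborel ?C) = ennreal (measure lborel (shadow (- I) K) / (real (card I) + 1))"
      using emeasure_apex_cone[OF K, of ?S i 0] emeasure_compact_eq_measure[OF cC] unfolding iS by simp
    thus ?thesis by (subst (asm) ennreal_inj) auto
  qed
  also have "real (a i) * measure lborel ?C = \<bar>prod ?m UNIV\<bar> * measure lebesgue ?C"
    using cC by (simp add: measure_lebesgue_compact prod.delta)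
  also have "\<dots> = measure lebesgue (?f ` ?C)"
    using measure_stretch[OF lmeasurable_compact[OF cC], of ?m] by simp
  also have "\<dots> \<le> measure lebesgue (shadow ?S H)"
    using sub cf H by (intro measure_mono_fmeasurable fmeasurableD lmeasurable_compact compact_shadow)
  also have "\<dots> = measure lborel (shadow ?S H)" using H by (intro measure_lebesgue_compact compact_shadow)
  finally show ?case unfolding H_def .
qed

text \<open>The arms start at 1, so they are disjoint and the origin is counted once.\<close>

definition star :: "('d \<Rightarrow> nat) \<Rightarrow> (real^'d) set" where
  "star a = insert 0 (\<Union>i. (\<lambda>k. real k *\<^sub>R axis i 1) ` {1..a i})"

lemma axis_mem_star: "k \<le> a i \<Longrightarrow> real k *\<^sub>R axis i 1 \<in> star a"
  unfolding star_def by (cases "k = 0") (simp, intro insertI2 UN_I[of i] image_eqI[of _ _ k], simp_all)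

lemma card_star:
  fixes a :: "'d::finite \<Rightarrow> nat"
  shows "finite (star a)" "card (star a) = Suc (sum a UNIV)"
proof -
  let ?A = "\<lambda>i. (\<lambda>k. real k *\<^sub>R axis i 1 :: real^'d) ` {1..a i}"
  have coord: "(real k *\<^sub>R axis i 1 :: real^'d) $ j = (if j = i then real k else 0)" for k i j
    by (simp add: axis_def)
  have card: "card (?A i) = a i" for i
  proof -
    have "inj_on (\<lambda>k. real k *\<^sub>R axis i 1 :: real^'d) {1..a i}"
      by (auto intro!: inj_onI)
    thus ?thesis by (simp add: card_image)
  qed
  have disj: "?A i \<inter> ?A j = {}" if "i \<noteq> j" for i j
  proof (rule ccontr)
    assume "?A i \<inter> ?A j \<noteq> {}"
    then obtain k l where "k \<in> {1..a i}" "(real k *\<^sub>R axis i 1 :: real^'d) = real l *\<^sub>R axis j 1" by blast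
    hence "(if i = i then real k else 0) = (if i = j then real l else 0)" using coord by metis
    thus False using that \<open>k \<in> {1..a i}\<close> by simp
  qed
  have "card (\<Union>i. ?A i) = (\<Sum>i\<in>UNIV. card (?A i))"
    by (intro card_UN_disjoint) (use disj in auto)
  hence "card (\<Union>i. ?A i) = sum a UNIV" unfolding card .
  moreover have "0 \<notin> (\<Union>i. ?A i)" by auto
  ultimately show "finite (star a)" "card (star a) = Suc (sum a UNIV)" unfolding star_def by auto
qed

lemma polyomino_star:
  fixes a :: "'d::finite \<Rightarrow> nat"
  shows "polyomino (Suc (sum a UNIV)) (unit_cube ` star a)"
proof -
  let ?P = "unit_cube ` star a"
  let ?R = "{(A, B). A \<in> ?P \<and> B \<in> ?P \<and> share_facet A B}"
  have "inj_on unit_cube (star a)" using inj_unit_cube inj_on_subset by blast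
  hence card: "card ?P = Suc (sum a UNIV)" by (simp add: card_image card_star)
  have "z$i \<in> \<int>" if "z \<in> star a" for z i
    using that unfolding star_def by (auto simp: axis_def)
  hence grid: "\<forall>C\<in>?P. grid_cube C"
    unfolding grid_cube_iff by blast
  have "sym ?R" by (auto simp: sym_def share_facet_def)
  have conn: "(unit_cube 0, unit_cube (real k *\<^sub>R axis i 1)) \<in> ?R\<^sup>*" if "k \<le> a i" for k i
    using that
  proof (induction k)
    case (Suc k)
    have "real k *\<^sub>R axis i 1 \<in> star a" "real (Suc k) *\<^sub>R axis i 1 \<in> star a"
      using Suc.prems by (simp_all add: axis_mem_star del: of_nat_Suc)
    moreover have "share_facet (unit_cube (real k *\<^sub>R axis i 1)) (unit_cube (real (Suc k) *\<^sub>R axis i 1 :: real^'d))"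
      using share_facet_unit_cubeI[of "real k *\<^sub>R axis i 1" i] by (simp add: algebra_simps)
    ultimately have "(unit_cube (real k *\<^sub>R axis i 1), unit_cube (real (Suc k) *\<^sub>R axis i 1)) \<in> ?R" by blast
    thus ?case using Suc by (meson Suc_leD rtrancl_into_rtrancl)
  qed simp
  have to: "(unit_cube 0, C) \<in> ?R\<^sup>*" if "C \<in> ?P" for C
    using that conn unfolding star_def by auto
  hence "(C, unit_cube 0) \<in> ?R\<^sup>*" if "C \<in> ?P" for C
    using that \<open>sym ?R\<close> by (meson sym_rtrancl symD)
  hence "(C, D) \<in> ?R\<^sup>*" if "C \<in> ?P" "D \<in> ?P" for C D
    using to that by (meson rtrancl_trans)
  with card grid show ?thesis unfolding polyomino_def by (simp add: card_star)
qed

text \<open>For every \<open>I\<close> the star contains the origin and the arm tips in the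
  directions \<open>I\<close>, the vertices of a simplex whose volume accounts for the summand of
  \<open>I\<close>.\<close>

lemma measure_hull_star_ge:
  fixes a :: "'d::finite \<Rightarrow> nat"
  shows "weight UNIV a \<le> measure lebesgue (convex hull (\<Union>(unit_cube ` star a)))"
proof -
  have "weight UNIV a \<le> (\<Sum>I\<in>UNIV. measure lborel (shadow (- I) (convex hull star a)))"
    unfolding weight_def Pow_UNIV
  proof (intro sum_mono)
    fix I :: "'d set"
    let ?V = "insert 0 ((\<lambda>i. real (a i) *\<^sub>R axis i 1 :: real^'d) ` I)"
    have "0 \<in> star a" by (simp add: star_def)
    hence "?V \<subseteq> star a" using axis_mem_star[of "a _" a] by blast
    hence sub: "shadow (- I) (convex hull ?V) \<subseteq> shadow (- I) (convex hull star a)"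
      by (intro shadow_mono hull_mono)
    have c: "compact (shadow (- I) (convex hull ?V))" "compact (shadow (- I) (convex hull star a))"
      by (auto intro!: compact_shadow simp: finite_imp_compact_convex_hull card_star)
    have "(\<Prod>i\<in>I. real (a i)) / fact (card I) \<le> measure lborel (shadow (- I) (convex hull ?V))"
      by (rule measure_shadow_simplex_ge) simp
    also have "\<dots> \<le> measure lborel (shadow (- I) (convex hull star a))"
      using measure_mono_fmeasurable[OF sub, of lebesgue] c
      by (simp add: lmeasurable_compact measure_lebesgue_compact fmeasurableD)
    finally show "(\<Prod>i\<in>I. real (a i)) / fact (card I) \<le> measure lborel (shadow (- I) (convex hull star a))" .
  qed
  thus ?thesis using measure_hull_unit_cubes[OF card_star(1), of a] by simp
qed

theorem theorem4:
  fixes n :: nat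
  assumes "n \<ge> 1"
  shows "is_maximum
    {measure lebesgue (convex hull (\<Union>P)) | P :: (real^'d::finite) set set. polyomino n P}
    (\<Sum>I\<in>Pow {1..CARD('d)}.
       1 / fact (card I) *
       (\<Prod>i\<in>I. real_of_int \<lfloor>(real n - 2 + real i) / real CARD('d)\<rfloor>))"
proof -
  let ?c = "\<lambda>k. (n - 1 + k - 1) div CARD('d)"
  let ?w = "weight {1..CARD('d)} ?c"
  have c: "balanced {1..CARD('d)} ?c" "sum ?c {1..CARD('d)} = n - 1"
    by (rule balanced_floor_shifts sum_floor_shifts, simp)+
  have le: "measure lebesgue (convex hull (\<Union>P)) \<le> ?w" if poly: "polyomino n P" for P :: "(real^'d) set set"
  proof -
    obtain a :: "'d \<Rightarrow> nat" where a: "sum a UNIV = n - 1" "measure lebesgue (convex hull (\<Union>P)) \<le> weight UNIV a"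
      using measure_hull_polyomino_le[OF poly assms] by blast
    obtain b :: "'d \<Rightarrow> nat" where b: "balanced UNIV b" "sum b UNIV = sum a UNIV" "weight UNIV a \<le> weight UNIV b"
      using exists_balanced[of UNIV a] by auto
    have "weight UNIV b = ?w" using a b c by (intro weight_balanced_eq) auto
    thus ?thesis using a b by simp
  qed
  \<comment> \<open>A numbering of the coordinates transfers the floors, indexed by
    \<open>{1..d}\<close>, to arm lengths.\<close>
  obtain f where f: "bij_betw f (UNIV :: 'd set) {1..CARD('d)}"
    using finite_same_card_bij[of "UNIV :: 'd set" "{1..CARD('d)}"] by auto
  let ?P = "unit_cube ` star (?c \<circ> f)"
  have "sum (?c \<circ> f) UNIV = n - 1" using sum.reindex_bij_betw[OF f, of ?c] c(2) by simp
  hence P: "polyomino n ?P" using polyomino_star[of "?c \<circ> f"] assms by simp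
  have "?w \<le> measure lebesgue (convex hull (\<Union>?P))"
    using measure_hull_star_ge[of "?c \<circ> f"] weight_reindex[OF f, of ?c] by simp
  \<comment> \<open>The star is itself subject to the upper bound, so the lower bound suffices to
    determine its volume.\<close>
  hence "measure lebesgue (convex hull (\<Union>?P)) = ?w" using le[OF P] by simp
  hence "?w \<in> {measure lebesgue (convex hull (\<Union>P)) | P :: (real^'d) set set. polyomino n P}"
    using P by (intro CollectI exI[of _ ?P]) simp
  thus ?thesis unfolding weight_floor_shifts[OF assms] is_maximum_def using le by blast
qed

end
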